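(* For every non-negative integer $n$, $$b(49n+37)\equiv 0 \pmod{49},$$ where $b(n)$ denotes the number of cubic partition pairs of $n$, i.e. the coefficients defined by $\sum_{n=0}^{\infty} b(n)q^n=\dfrac{1}{(q;q)_\infty^2\,(q^2;q^2)_\infty^2}$.
   Context: For $|q|<1$, $(a;q)_\infty:=\prod_{n\ge 0}(1-aq^n)$; thus $(q^j;q^j)_\infty=\prod_{n\ge 1}(1-q^{jn})$ for a positive integer $j$. The integers $b(n)$, $n\ge 0$, are the coefficients of the power series $\sum_{n=0}^{\infty} b(n)q^n=\frac{1}{(q;q)_\infty^2(q^2;q^2)_\infty^2}$. *)

theory Defs
  imports "HOL-Analysis.Analysis" "HOL-Number_Theory.Cong"
begin

definition qpoch_inf :: "'a \<Rightarrow> 'a \<Rightarrow> 'a::{t2_space, comm_ring_1}" where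
  "qpoch_inf a q = (\<Prod>n. 1 - a * q ^ n)"

definition cubic_pair_denom :: "int fps" where
  "cubic_pair_denom = (qpoch_inf fps_X fps_X)\<^sup>2 * (qpoch_inf (fps_X\<^sup>2) (fps_X\<^sup>2))\<^sup>2"

text \<open>The type of integers is not of class \<open>inverse\<close>, so the reciprocal in the ring of integer power
  series is written with \<^const>\<open>fps_right_inverse_constructor\<close>, through the abbreviation
  \<open>fps_right_inverse\<close>; its second argument is the inverse of the constant coefficient,
  which here is 1. Lemma \<open>cubic_pair_gf_unique\<close> below confirms that this is the reciprocal.\<close>
definition cubic_pair_gf :: "int fps" where
  "cubic_pair_gf = fps_right_inverse cubic_pair_denom 1"

definition b :: "nat \<Rightarrow> int" where
  "b n = fps_nth cubic_pair_gf n"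

text \<open>The products converge in the topology of formal power series, so \<^const>\<open>qpoch_inf\<close> has no
  junk value here.\<close>

lemma fps_nth_prod_qpoch:
  assumes "j > 0" "k < m" "m \<le> N"
  shows "fps_nth (\<Prod>i<N. 1 - (fps_X ^ j :: int fps) * (fps_X ^ j) ^ i) k =
         fps_nth (\<Prod>i<m. 1 - (fps_X ^ j :: int fps) * (fps_X ^ j) ^ i) k"
  using assms(3)
proof (induction N rule: dec_induct)
  case (step N)
  have "k < j * Suc N"
    using assms step.hyps by (cases j) auto
  moreover have "(fps_X ^ j :: int fps) * (fps_X ^ j) ^ N = fps_X ^ (j * Suc N)"
    by (simp only: power_mult power_Suc)
  ultimately have "fps_nth (P * (1 - (fps_X ^ j :: int fps) * (fps_X ^ j) ^ N)) k = fps_nth P k" for P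
    by (simp only: right_diff_distrib fps_sub_nth fps_X_power_mult_right_nth) simp
  with step show ?case
    by simp
qed simp

lemma
  assumes "j > 0"
  shows has_prod_qpoch_inf_fps:
      "(\<lambda>n. 1 - (fps_X ^ j :: int fps) * (fps_X ^ j) ^ n) has_prod qpoch_inf (fps_X ^ j) (fps_X ^ j)"
    and fps_nth_0_qpoch_inf: "fps_nth (qpoch_inf (fps_X ^ j) (fps_X ^ j) :: int fps) 0 = 1"
proof -
  define f :: "nat \<Rightarrow> int fps" where "f n = 1 - fps_X ^ j * (fps_X ^ j) ^ n" for n
  define P where "P = Abs_fps (\<lambda>k. fps_nth (\<Prod>i<Suc k. f i) k)"
  have P0: "fps_nth P 0 = 1"
    using assms by (simp add: P_def f_def)
  have "(\<lambda>n. \<Prod>i\<le>n. f i) \<longlonglongrightarrow> P"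
  proof (rule tendsto_fpsI)
    fix k
    show "eventually (\<lambda>n. fps_nth (\<Prod>i\<le>n. f i) k = fps_nth P k) sequentially"
      using eventually_ge_at_top[of k]
    proof eventually_elim
      case (elim n)
      then have "fps_nth (\<Prod>i<Suc n. f i) k = fps_nth (\<Prod>i<Suc k. f i) k"
        unfolding f_def by (intro fps_nth_prod_qpoch assms) auto
      then show ?case
        unfolding P_def lessThan_Suc_atMost by simp
    qed
  qed
  moreover have "P \<noteq> 0"
    using P0 by auto
  ultimately have prod: "f has_prod P"
    by (simp add: has_prod_def raw_has_prod_def)
  then have "qpoch_inf (fps_X ^ j) (fps_X ^ j) = P"
    unfolding qpoch_inf_def f_def [symmetric] by (rule has_prod_unique [symmetric])
  with prod P0 show
      "(\<lambda>n. 1 - (fps_X ^ j :: int fps) * (fps_X ^ j) ^ n) has_prod qpoch_inf (fps_X ^ j) (fps_X ^ j)"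
      "fps_nth (qpoch_inf (fps_X ^ j) (fps_X ^ j) :: int fps) 0 = 1"
    unfolding f_def by simp_all
qed

lemma cubic_pair_gf_unique: "cubic_pair_denom * g = 1 \<longleftrightarrow> g = cubic_pair_gf"
proof -
  have "fps_nth cubic_pair_denom 0 = 1"
    using fps_nth_0_qpoch_inf[of 1] fps_nth_0_qpoch_inf[of 2]
    by (simp add: cubic_pair_denom_def fps_nth_power_0)
  then have inv: "cubic_pair_denom * cubic_pair_gf = 1"
    unfolding cubic_pair_gf_def by (intro fps_right_inverse) simp
  then show ?thesis
    by (metis mult.commute mult.left_commute mult.right_neutral)
qed

end

theory Submission
  imports Defs
begin

text \<open>
  Write \<open>E\<^sub>k\<close> for \<open>\<Prod>n\<ge>1. 1 - q^(k n)\<close>. Since \<open>E\<^sub>k^7 \<equiv> E\<^sub>7\<^sub>k\<close> modulo 7, the product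
  \<open>(E\<^sub>1^7 - E\<^sub>7) (E\<^sub>2^7 - E\<^sub>1\<^sub>4)\<close> vanishes modulo 49, so that modulo 49
  \<open>1 / (E\<^sub>1^2 E\<^sub>2^2) \<equiv> H / E\<^sub>7 + K / E\<^sub>1\<^sub>4 - E\<^sub>1^5 E\<^sub>2^5 / (E\<^sub>7 E\<^sub>1\<^sub>4)\<close> with
  \<open>H = E\<^sub>1^5 / E\<^sub>2^2 = \<Sum> (6n+1) q^(n(3n+1)/2)\<close> and
  \<open>K = E\<^sub>2^5 / E\<^sub>1^2 = \<Sum> (-1)^n (3n+1) q^(3n^2+2n)\<close>, the sums being over all integers.
  In a term of \<open>H / E\<^sub>7\<close> or \<open>K / E\<^sub>1\<^sub>4\<close> with exponent 37 modulo 49, the weight \<open>6n+1\<close> or \<open>3n+1\<close> is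
  divisible by 7, and the other factor is a partition number \<open>p(7k+5)\<close>, divisible by 7 by Ramanujan's congruence.
  For the last summand, \<open>-12 E\<^sub>1^5 E\<^sub>2^5\<close> is a Wronskian of two theta functions, which is a double series with
  weight divisible by \<open>(2j+1)(2k+1)\<close> and exponent \<open>((2j+1)^2 + 4(2k+1)^2 - 5)/8\<close>;
  if the exponent is 2 modulo 7, then 7 divides both \<open>2j+1\<close> and \<open>2k+1\<close>.
\<close>

subsection \<open>Limits of formal power series\<close>

text \<open>The class 37 solves 4 N = 1 modulo 49: after the factor q^(-1/4) that turns the
  generating function into an eta quotient, it selects the exponents N - 1/4 divisible by 49. One
  factor 7 per piece is not enough, so each piece draws two from independent sources: a weight and a
  partition number, or two weights. The latter works because -1 is not a square modulo 7. The sums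
  for \<open>H\<close> and \<open>K\<close> come from Jacobi's series for a cube times a theta
  series. The resulting binary quadratic form has a reflection that cancels one class modulo 3 of
  the lattice; a symmetry swaps the other two, and on each of them suitable coordinates separate the
  form. For the Wronskian, let A = 2 E_1(-q)^3 and B = 2 E_4^3. Then (A/B)^2 is a constant times the
  cube of a quotient of two theta functions, so the Wronskian of A and B reduces to that of the two
  theta functions, which is a multiple of E_1^6. Product identities are limits of finite ones.
  Quotients are stated multiplied out, and common factors are cancelled in the domain
  \<open>int fps\<close>.\<close>

lemma eventually_fps_nth_le:
  fixes L :: "'a::group_add fps"
  assumes "(f \<longlongrightarrow> L) F"
  shows "\<forall>\<^sub>F x in F. \<forall>k\<le>n. fps_nth (f x) k = fps_nth L k"
proof -
  have "\<forall>\<^sub>F x in F. \<forall>k\<in>{..n}. fps_nth (f x) k = fps_nth L k"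
    using assms by (subst eventually_ball_finite_distrib) (auto simp: tendsto_fps_iff)
  then show ?thesis
    by eventually_elim simp
qed

lemma tendsto_mult_fps:
  fixes a b :: "'a::ring_1 fps"
  assumes "(f \<longlongrightarrow> a) F" "(g \<longlongrightarrow> b) F"
  shows "((\<lambda>x. f x * g x) \<longlongrightarrow> a * b) F"
proof (rule tendsto_fpsI)
  fix n
  show "\<forall>\<^sub>F x in F. fps_nth (f x * g x) n = fps_nth (a * b) n"
    using eventually_fps_nth_le[OF assms(1), of n] eventually_fps_nth_le[OF assms(2), of n]
    by eventually_elim (simp add: fps_mult_nth)
qed

lemma tendsto_add_fps:
  fixes a b :: "'a::ring_1 fps"
  assumes "(f \<longlongrightarrow> a) F" "(g \<longlongrightarrow> b) F"
  shows "((\<lambda>x. f x + g x) \<longlongrightarrow> a + b) F"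
proof (rule tendsto_fpsI)
  fix n
  show "\<forall>\<^sub>F x in F. fps_nth (f x + g x) n = fps_nth (a + b) n"
    using eventually_fps_nth_le[OF assms(1), of n] eventually_fps_nth_le[OF assms(2), of n]
    by eventually_elim simp
qed

lemma tendsto_power_fps:
  fixes a :: "'a::ring_1 fps"
  assumes "(f \<longlongrightarrow> a) F"
  shows "((\<lambda>x. f x ^ n) \<longlongrightarrow> a ^ n) F"
  by (induction n) (auto intro: tendsto_mult_fps assms)

text \<open>Once the coefficients of \<open>f x\<close> up to n vanish, so do those of
  \<open>f x * h x\<close>, whatever \<open>h\<close> is. In \<open>qbinom_eu_tendsto\<close> the
  factor \<open>h\<close> is a Gaussian binomial whose convergence is still to be shown.\<close>

lemma tendsto_null_mult_fps:
  fixes f :: "_ \<Rightarrow> 'a::ring_1 fps"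
  assumes "(f \<longlongrightarrow> 0) F"
  shows "((\<lambda>x. f x * h x) \<longlongrightarrow> 0) F"
proof (rule tendsto_fpsI)
  fix n
  show "\<forall>\<^sub>F x in F. fps_nth (f x * h x) n = fps_nth 0 n"
    using eventually_fps_nth_le[OF assms, of n]
    by eventually_elim (simp add: fps_mult_nth)
qed

subsection \<open>Infinite products of sparse binomials\<close>

text \<open>In classical notation (-c q^r; q^s)_m. The sign c covers both the Euler products (c =
  -1) and the products with plus signs in theta functions (c = 1).\<close>

definition qprod :: "int \<Rightarrow> nat \<Rightarrow> nat \<Rightarrow> nat \<Rightarrow> int fps" where
  "qprod c r s m = (\<Prod>i<m. 1 + fps_const c * fps_X ^ (r + s * i))"

text \<open>For s > 0 the factors with index i > k do not affect coefficient k, so k + 1 factors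
  already give its final value.\<close>

definition qprod_inf :: "int \<Rightarrow> nat \<Rightarrow> nat \<Rightarrow> int fps" where
  "qprod_inf c r s = Abs_fps (\<lambda>k. fps_nth (qprod c r s (Suc k)) k)"

lemma qprod_Suc: "qprod c r s (Suc m) = qprod c r s m * (1 + fps_const c * fps_X ^ (r + s * m))"
  by (simp add: qprod_def)

lemma qprod_0 [simp]: "qprod c r s 0 = 1"
  by (simp add: qprod_def)

lemma qprod_Suc_shift: "qprod c r s (Suc m) = (1 + fps_const c * fps_X ^ r) * qprod c (r + s) s m"
  unfolding qprod_def prod.lessThan_Suc_shift by (simp add: algebra_simps)

lemma fps_nth_qprod:
  assumes "s > 0" "k < m" "m \<le> N"
  shows "fps_nth (qprod c r s N) k = fps_nth (qprod c r s m) k"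
  using assms(3)
proof (induction N rule: dec_induct)
  case (step N)
  have "k < N" "N \<le> s * N"
    using assms step.hyps by auto
  then have "k < r + s * N"
    by linarith
  then have "fps_nth (P * (1 + fps_const c * fps_X ^ (r + s * N))) k = fps_nth P k" for P
    by (simp add: distrib_left mult.assoc [symmetric] fps_X_power_mult_right_nth)
  with step show ?case
    by (simp add: qprod_Suc)
qed simp

lemma qprod_tendsto:
  assumes "s > 0"
  shows "qprod c r s \<longlonglongrightarrow> qprod_inf c r s"
proof (rule tendsto_fpsI)
  fix k
  show "\<forall>\<^sub>F m in sequentially. fps_nth (qprod c r s m) k = fps_nth (qprod_inf c r s) k"
    using eventually_ge_at_top[of "Suc k"]
    by eventually_elim (simp add: qprod_inf_def fps_nth_qprod assms)
qed

text \<open>Uniqueness of limits along a subsequence of partial products. Regrouping factors in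
  finite products with m, 2m or 3m factors thus gives identities of infinite products.\<close>

lemma qprod_inf_eqI:
  assumes "s > 0" "filterlim g at_top sequentially" "(\<lambda>m. qprod c r s (g m)) \<longlonglongrightarrow> L"
  shows "qprod_inf c r s = L"
  using LIMSEQ_unique[OF filterlim_compose[OF qprod_tendsto assms(2)] assms(3)] assms(1) .

lemma qprod_inf_shift:
  assumes "s > 0"
  shows "qprod_inf c r s = (1 + fps_const c * fps_X ^ r) * qprod_inf c (r + s) s"
proof (rule qprod_inf_eqI[OF assms filterlim_Suc])
  show "(\<lambda>m. qprod c r s (Suc m)) \<longlonglongrightarrow> (1 + fps_const c * fps_X ^ r) * qprod_inf c (r + s) s"
    unfolding qprod_Suc_shift
    by (intro tendsto_mult_fps tendsto_const qprod_tendsto assms)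
qed

definition eu :: "nat \<Rightarrow> int fps" where
  "eu r = qpoch_inf (fps_X ^ r) (fps_X ^ r)"

lemma qprod_eu: "qprod (-1) r r m = (\<Prod>i<m. 1 - (fps_X ^ r :: int fps) * (fps_X ^ r) ^ i)"
  by (simp add: qprod_def power_add power_mult flip: fps_const_neg)

lemma qprod_inf_eu:
  assumes "r > 0"
  shows "qprod_inf (-1) r r = eu r"
proof (rule qprod_inf_eqI[OF assms filterlim_Suc])
  have "(\<lambda>m. \<Prod>i\<le>m. 1 - (fps_X ^ r :: int fps) * (fps_X ^ r) ^ i) \<longlonglongrightarrow> eu r"
    using has_prod_qpoch_inf_fps[OF assms] fps_nth_0_qpoch_inf[OF assms]
    by (auto simp: has_prod_def raw_has_prod_def eu_def)
  then show "(\<lambda>m. qprod (- 1) r r (Suc m)) \<longlonglongrightarrow> eu r"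
    by (simp only: qprod_eu lessThan_Suc_atMost)
qed

lemma eu_tendsto: "r > 0 \<Longrightarrow> qprod (-1) r r \<longlonglongrightarrow> eu r"
  using qprod_tendsto[of r "-1" r] by (simp add: qprod_inf_eu)

lemma eu_nth_0 [simp]: "r > 0 \<Longrightarrow> fps_nth (eu r) 0 = 1"
  by (simp add: eu_def fps_nth_0_qpoch_inf)

lemma eu_nonzero [simp]: "r > 0 \<Longrightarrow> eu r \<noteq> 0"
  by (metis eu_nth_0 fps_zero_nth zero_neq_one)

subsection \<open>Gaussian binomial coefficients\<close>

text \<open>Pascal's rule instead of a quotient of q-factorials gives a definition in any
  commutative ring, without division.\<close>

fun qbinom :: "'a::comm_ring_1 \<Rightarrow> nat \<Rightarrow> nat \<Rightarrow> 'a" where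
  "qbinom q n 0 = 1"
| "qbinom q 0 (Suc k) = 0"
| "qbinom q (Suc n) (Suc k) = qbinom q n k + q ^ Suc k * qbinom q n (Suc k)"

lemma qbinom_eq_0: "k > n \<Longrightarrow> qbinom q n k = 0"
  by (induction q n k rule: qbinom.induct) auto

lemma qbinom_self [simp]: "qbinom q n n = 1"
  by (induction n) (auto simp: qbinom_eq_0)

text \<open>The quotient formula with denominators cleared. The induction rests on (1 - q^(k+1)) +
  q^(k+1) (1 - q^(d+1)) = 1 - q^(n+1) for n = k + 1 + d.\<close>

lemma qbinom_fact:
  fixes q :: "'a::comm_ring_1"
  defines "P \<equiv> \<lambda>n. \<Prod>i<n. 1 - q ^ Suc i"
  assumes "k \<le> n"
  shows "qbinom q n k * P k * P (n - k) = P n"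
  using assms(2)
proof (induction n arbitrary: k)
  case (Suc n k')
  show ?case
  proof (cases k') 
  case (Suc k)
  have P_Suc: "P (Suc j) = P j * (1 - q ^ Suc j)" for j
    by (simp add: P_def)
  have 1: "qbinom q n k * P k * P (n - k) = P n"
    using Suc.IH[of k] Suc.prems Suc by simp
  show ?thesis
  proof (cases "k < n")
    case True
    then obtain d where d: "n - k = Suc d" "n - Suc k = d" "n = Suc k + d"
      by (metis Suc_diff_Suc add_Suc_right add_Suc le_add_diff_inverse less_imp_le)
    have 2: "qbinom q n (Suc k) * P (Suc k) * P d = P n"
      using Suc.IH[of "Suc k"] True d by simp
    have "qbinom q (Suc n) (Suc k) * P (Suc k) * P (Suc n - Suc k) =
        (qbinom q n k * P k * P (n - k)) * (1 - q ^ Suc k)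
        + q ^ Suc k * (1 - q ^ Suc d) * (qbinom q n (Suc k) * P (Suc k) * P d)"
      using d by (simp add: P_Suc algebra_simps)
    also have "\<dots> = P n * (1 - q ^ Suc k * q ^ Suc d)"
      unfolding 1 2 by (simp add: algebra_simps)
    also have "q ^ Suc k * q ^ Suc d = q ^ Suc n"
      by (simp add: d power_add)
    finally show ?thesis
      unfolding Suc by (simp add: P_Suc)
  next
    case False
    with Suc Suc.prems have "k = n" by simp
    then show ?thesis
      by (simp add: Suc qbinom_eq_0 P_def)
  qed
qed (simp add: P_def)
qed (simp add: P_def)

text \<open>The homogeneous form with y allows y = q^m later, which centres the product without
  negative powers of q.\<close>

theorem qbinomial_theorem:
  fixes x y q :: "'a::comm_ring_1"
  shows "(\<Prod>i<n. y + x * q ^ i) = (\<Sum>k\<le>n. qbinom q n k * q ^ (k choose 2) * x ^ k * y ^ (n - k))"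
proof (induction n arbitrary: x)
  case (Suc n)
  have choose2: "Suc k choose 2 = k + (k choose 2)" for k
    by (simp add: numeral_2_eq_2)
  \<comment> \<open>Splitting off the factor i = 0 leaves the product for n at x q, hence the
    generalisation over x.\<close>
  have "(\<Prod>i<Suc n. y + x * q ^ i) = (y + x) * (\<Prod>i<n. y + (x * q) * q ^ i)"
    unfolding prod.lessThan_Suc_shift by (simp add: algebra_simps)
  also have "\<dots> = y * (\<Sum>k\<le>n. qbinom q n k * q ^ (k choose 2) * (x * q) ^ k * y ^ (n - k))
               + x * (\<Sum>k\<le>n. qbinom q n k * q ^ (k choose 2) * (x * q) ^ k * y ^ (n - k))"
    unfolding Suc.IH by (rule distrib_right)
  also have "y * (\<Sum>k\<le>n. qbinom q n k * q ^ (k choose 2) * (x * q) ^ k * y ^ (n - k)) =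
      (\<Sum>k\<le>Suc n. qbinom q n k * q ^ (k choose 2) * (x * q) ^ k * y ^ (Suc n - k))"
    by (simp add: sum_distrib_left qbinom_eq_0 Suc_diff_le mult_ac)
  also have "\<dots> = y ^ Suc n + (\<Sum>k\<le>n. qbinom q n (Suc k) * q ^ (Suc k choose 2) * (x * q) ^ Suc k * y ^ (n - k))"
    by (subst sum.atMost_Suc_shift) (simp add: binomial_eq_0)
  also have "\<dots> + x * (\<Sum>k\<le>n. qbinom q n k * q ^ (k choose 2) * (x * q) ^ k * y ^ (n - k)) =
     y ^ Suc n + (\<Sum>k\<le>n. qbinom q (Suc n) (Suc k) * q ^ (Suc k choose 2) * x ^ Suc k * y ^ (n - k))"
    unfolding sum_distrib_left add.assoc sum.distrib [symmetric]
    by (intro arg_cong2[of _ _ _ _ "(+)"] refl sum.cong)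
       (simp add: choose2 power_add power_mult_distrib algebra_simps)
  also have "\<dots> = (\<Sum>k\<le>Suc n. qbinom q (Suc n) k * q ^ (k choose 2) * x ^ k * y ^ (Suc n - k))"
    by (subst sum.atMost_Suc_shift) (simp add: binomial_eq_0)
  finally show ?case .
qed (simp add: binomial_eq_0)

subsection \<open>Series indexed by arbitrary sets\<close>

text \<open>The sum of \<open>c i * q ^ e i\<close> over \<open>i \<in> I\<close>. Terms with \<open>e i < 0\<close> are dropped, and a coefficient is 0 if
  infinitely many indices contribute to it; \<open>admissible\<close> excludes both.\<close>

definition iseries :: "'i set \<Rightarrow> ('i \<Rightarrow> int) \<Rightarrow> ('i \<Rightarrow> int) \<Rightarrow> int fps" where
  "iseries I e c = Abs_fps (\<lambda>n. \<Sum>i | i \<in> I \<and> e i = int n. c i)"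

definition admissible :: "'i set \<Rightarrow> ('i \<Rightarrow> int) \<Rightarrow> bool" where
  "admissible I e \<longleftrightarrow> (\<forall>i\<in>I. 0 \<le> e i) \<and> (\<forall>n. finite {i \<in> I. e i \<le> n})"

lemma iseries_nth: "fps_nth (iseries I e c) n = (\<Sum>i | i \<in> I \<and> e i = int n. c i)"
  by (simp add: iseries_def)

lemma admissible_subset:
  assumes "admissible I e" "J \<subseteq> I"
  shows "admissible J e"
proof -
  have "finite {i \<in> J. e i \<le> n}" for n
    using assms by (intro finite_subset[of "{i \<in> J. e i \<le> n}" "{i \<in> I. e i \<le> n}"]) (auto simp: admissible_def)
  with assms show ?thesis
    by (auto simp: admissible_def)
qed

lemma admissible_fibre: "admissible I e \<Longrightarrow> finite {i \<in> I. e i = n}"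
  unfolding admissible_def by (auto intro: finite_subset[of _ "{i \<in> I. e i \<le> n}"])

lemma admissibleI_abs:
  fixes e :: "int \<Rightarrow> int"
  assumes "\<And>n. \<bar>n\<bar> \<le> e n + k"  "\<And>n. 0 \<le> e n"
  shows "admissible I e"
  unfolding admissible_def
proof (intro conjI allI ballI)
  fix N
  have "{i \<in> I. e i \<le> N} \<subseteq> {- (N + k)..N + k}"
    using assms(1) by (smt (verit) atLeastAtMost_iff mem_Collect_eq subsetI)
  then show "finite {i \<in> I. e i \<le> N}"
    by (rule finite_subset) simp
qed (use assms in auto)

text \<open>Termwise passage to the limit. By admissibility only finitely many indices reach
  coefficient n, and their contributions are eventually constant; this plays the part of dominated
  convergence.\<close>

lemma tendsto_iseries:
  fixes e :: "'i \<Rightarrow> int" and C :: "nat \<Rightarrow> 'i \<Rightarrow> int fps"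
  assumes adm: "admissible I e"
    and J: "\<And>m. finite (J m)" "\<And>m. J m \<subseteq> I"
    and ev: "\<And>i. i \<in> I \<Longrightarrow> \<forall>\<^sub>F m in sequentially. i \<in> J m"
    and lim: "\<And>i. i \<in> I \<Longrightarrow> (\<lambda>m. C m i) \<longlonglongrightarrow> fps_const (c i)"
  shows "(\<lambda>m. \<Sum>i\<in>J m. C m i * fps_X ^ nat (e i)) \<longlonglongrightarrow> iseries I e c"
proof (rule tendsto_fpsI)
  fix n
  define T where "T = {i \<in> I. e i \<le> int n}"
  have T: "finite T"
    using adm by (auto simp: T_def admissible_def)
  have "\<forall>\<^sub>F m in sequentially. \<forall>i\<in>T. i \<in> J m \<and> (\<forall>j\<le>n. fps_nth (C m i) j = fps_nth (fps_const (c i)) j)"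
    unfolding eventually_ball_finite_distrib[OF T]
    by (intro ballI eventually_conj ev eventually_fps_nth_le lim) (auto simp: T_def)
  then show "\<forall>\<^sub>F m in sequentially. fps_nth (\<Sum>i\<in>J m. C m i * fps_X ^ nat (e i)) n = fps_nth (iseries I e c) n"
  proof eventually_elim
    case (elim m)
    have nn: "0 \<le> e i" if "i \<in> I" for i
      using adm that by (auto simp: admissible_def)
    have "fps_nth (\<Sum>i\<in>J m. C m i * fps_X ^ nat (e i)) n =
        (\<Sum>i\<in>J m. if n < nat (e i) then 0 else fps_nth (C m i) (n - nat (e i)))"
      by (simp add: fps_sum_nth fps_X_power_mult_right_nth)
    also have "\<dots> = (\<Sum>i\<in>T. if n < nat (e i) then 0 else fps_nth (C m i) (n - nat (e i)))"
      using elim J(1)[of m] J(2)[of m] by (intro sum.mono_neutral_right) (auto simp: T_def)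
    also have "\<dots> = (\<Sum>i\<in>T. if e i = int n then c i else 0)"
      using elim nn by (intro sum.cong refl) (auto simp: T_def nat_le_iff)
    also have "\<dots> = fps_nth (iseries I e c) n"
      unfolding iseries_nth using T by (simp add: sum.inter_filter [symmetric] T_def Collect_conj_eq [symmetric])
        (intro sum.cong, auto)
    finally show ?case .
  qed
qed

text \<open>The binomial tends to 1 / \<open>eu r\<close> when both its lower index and the
  complement tend to infinity, as the quotient formula suggests.\<close>

lemma qbinom_eu_tendsto:
  assumes "r > 0" "filterlim f at_top sequentially" "filterlim g at_top sequentially"
    "\<forall>\<^sub>F m in sequentially. f m \<le> N m \<and> g m = N m - f m"
  shows "(\<lambda>m. qbinom (fps_X ^ r) (N m) (f m) * eu r) \<longlonglongrightarrow> 1"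
proof -
  define P where "P = qprod (-1) r r"
  define u where "u = (\<lambda>m. qbinom (fps_X ^ r :: int fps) (N m) (f m))"
  have N: "filterlim N at_top sequentially"
    using assms(2) by (rule filterlim_at_top_mono) (use assms(4) in eventually_elim, simp)
  have P: "P n = (\<Prod>i<n. 1 - (fps_X ^ r) ^ Suc i)" for n
    by (simp add: P_def qprod_eu)
  have lim: "(\<lambda>m. P (h m)) \<longlonglongrightarrow> eu r" if "filterlim h at_top sequentially" for h
    unfolding P_def using filterlim_compose[OF eu_tendsto that] assms(1) by simp
  \<comment> \<open>The bracket tends to 0, so its product with \<open>u m\<close> does too,
    although \<open>u\<close> is not yet known to converge. This trades
    \<open>P (f m) * P (g m)\<close> for \<open>eu r * eu r\<close> in the quotient formula.\<close>
  have "(\<lambda>m. eu r * eu r + (-1) * (P (f m) * P (g m))) \<longlonglongrightarrow> eu r * eu r + (-1) * (eu r * eu r)"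
    by (intro tendsto_add_fps tendsto_mult_fps tendsto_const lim assms)
  then have "(\<lambda>m. (eu r * eu r + (-1) * (P (f m) * P (g m))) * u m + P (N m)) \<longlonglongrightarrow> 0 + eu r"
    by (intro tendsto_add_fps tendsto_null_mult_fps lim N) simp
  moreover have "\<forall>\<^sub>F m in sequentially. (eu r * eu r + (-1) * (P (f m) * P (g m))) * u m + P (N m) = u m * eu r * eu r"
    using assms(4)
  proof eventually_elim
    case (elim m)
    then have "u m * P (f m) * P (g m) = P (N m)"
      unfolding P u_def using qbinom_fact[of "f m" "N m" "fps_X ^ r :: int fps"] by simp
    then show ?case
      by (simp add: algebra_simps)
  qed
  ultimately have lim2: "(\<lambda>m. u m * eu r * eu r) \<longlonglongrightarrow> eu r"
    by (simp add: tendsto_cong)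
  obtain g where g: "eu r * g = 1"
    using fps_right_inverse[of "eu r" 1] assms(1) by auto
  have "(\<lambda>m. u m * eu r * eu r * g) \<longlonglongrightarrow> eu r * g"
    by (intro tendsto_mult_fps lim2 tendsto_const)
  then show ?thesis
    by (simp add: g mult.assoc u_def)
qed

section \<open>The Jacobi triple product, finite and infinite\<close>

lemma prod_lessThan_add: "(\<Prod>i<m + n. f i) = (\<Prod>i<m. f i) * (\<Prod>i<n. f (m + i :: nat) :: 'a::comm_monoid_mult)"
  by (induction n) (simp_all add: mult.assoc)

lemma prod_mult_power_choose: "(\<Prod>i<m. z * q ^ i) = z ^ m * q ^ (m choose 2)" for z :: "'a::comm_semiring_1"
  by (induction m) (simp_all add: binomial_eq_0 power_add mult_ac numeral_2_eq_2)

lemma int_choose_two: "2 * int (n choose 2) = int n * (int n - 1)"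
  by (induction n) (simp_all add: binomial_eq_0 numeral_2_eq_2 algebra_simps)

lemma two_mult_half_pred: "2 * (n * (n - 1) div 2) = n * (n - 1)" for n :: int
  by simp

text \<open>For n < 0 the exponent is regrouped as s (t + n) + (s - r) (-n). Both terms are
  nonnegative, since t + n = n (n + 1) / 2 and r <= s.\<close>

lemma jtp_exponent_nonneg:
  assumes "r \<le> s"
  shows "0 \<le> int r * n + int s * (n * (n - 1) div 2)"
proof -
  define t where "t = n * (n - 1) div 2"
  have t: "2 * t = n * (n - 1)"
    unfolding t_def by (rule two_mult_half_pred)
  show ?thesis
  proof (cases "n \<ge> 0")
    case True
    then have "0 \<le> n * (n - 1)"
      by (cases "n = 0") auto
    with True t show ?thesis
      by (simp flip: t_def)
  next
    case False
    then have "0 \<le> n * (n + 1)"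
      by (intro mult_nonpos_nonpos) auto
    then have "0 \<le> t + n"
      using t by (simp add: algebra_simps)
    then have "0 \<le> int s * (t + n)"
      by simp
    moreover have "0 \<le> (int s - int r) * (- n)"
      using False assms by (intro mult_nonneg_nonneg) auto
    ultimately have "0 \<le> int s * (t + n) + (int s - int r) * (- n)"
      by (rule add_nonneg_nonneg)
    also have "\<dots> = int r * n + int s * t"
      by (simp add: algebra_simps)
    finally show ?thesis
      unfolding t_def .
  qed
qed

text \<open>Linear growth for \<open>admissibleI_abs\<close>. The 1 is needed where the exponent is
  0 at a nonzero index: at n = 1 if r = 0, and at n = -1 if r = s.\<close>

lemma jtp_exponent_bound:
  assumes "r \<le> s" "s > 0"
  shows "\<bar>n\<bar> \<le> int r * n + int s * (n * (n - 1) div 2) + 1"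
proof -
  define t where "t = n * (n - 1) div 2"
  have t: "2 * t = n * (n - 1)"
    unfolding t_def by (rule two_mult_half_pred)
  show ?thesis
  proof (cases "n > 0")
    case True
    then have "0 \<le> (n - 1) * (n - 2)"
      by (cases "n = 1") auto
    then have tn: "n - 1 \<le> t"
      using t by (simp add: algebra_simps)
    then have "1 * t \<le> int s * t"
      using assms True by (intro mult_right_mono) auto
    moreover have "0 \<le> int r * n"
      using True by simp
    ultimately have "n \<le> int r * n + int s * t + 1"
      using tn by linarith
    then show ?thesis
      using True by (simp flip: t_def)
  next
    case False
    have "0 \<le> (n + 1) * (n + 2)"
      by (cases "n \<ge> -1"; cases "n = -1") (auto intro: mult_nonpos_nonpos)
    then have tn: "- n - 1 \<le> t + n"
      using t by (simp add: algebra_simps)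
    have "0 \<le> n * (n + 1)"
      using False by (cases "n = 0") (auto intro: mult_nonpos_nonpos)
    then have "0 \<le> t + n"
      using t by (simp add: algebra_simps)
    then have "1 * (t + n) \<le> int s * (t + n)"
      using assms by (intro mult_right_mono) auto
    moreover have "0 \<le> (int s - int r) * (- n)"
      using assms False by (intro mult_nonneg_nonneg) auto
    ultimately have "- n \<le> int s * (t + n) + (int s - int r) * (- n) + 1"
      using tn unfolding mult_1_left by linarith
    also have "int s * (t + n) + (int s - int r) * (- n) = int r * n + int s * t"
      by (simp add: algebra_simps)
    finally have "- n \<le> int r * n + int s * t + 1" .
    then show ?thesis
      using False by (simp flip: t_def)
  qed
qed

text \<open>Cauchy's finite form: the q-binomial theorem with 2 m factors and y = q^m. The upper
  half of the factors gives the product for r. The lower half, with z q^i taken out and the order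
  reversed, gives the one for s - r, where c is its own inverse.\<close>

lemma jacobi_triple_product_finite:
  assumes c: "c = 1 \<or> c = -1" and rs: "r \<le> s"
  shows "qprod c r s m * qprod c (s - r) s m =
    (\<Sum>n=-int m..int m. (qbinom (fps_X ^ s) (2 * m) (nat (int m + n)) * fps_const (c ^ nat \<bar>n\<bar>))
       * fps_X ^ nat (int r * n + int s * (n * (n - 1) div 2)))"
proof -
  define q where "q = (fps_X ^ s :: int fps)"
  define z where "z = fps_const c * fps_X ^ r"
  \<comment> \<open>The total power of the variable taken out of the two halves: s m^2 from the
    upper one, the rest from the lower one. It cancels at the end.\<close>
  define K where "K = s * m\<^sup>2 + r * m + s * (m choose 2)"
  have cc: "fps_const c * fps_const c = 1"
    using c by auto
  have "(\<Prod>i<2*m. q ^ m + z * q ^ i) = (\<Prod>i<m. q ^ m + z * q ^ i) * (\<Prod>i<m. q ^ m + z * q ^ (m + i))"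
   
    unfolding mult_2 by (rule prod_lessThan_add)
  also have "(\<Prod>i<m. q ^ m + z * q ^ (m + i)) = q ^ (m\<^sup>2) * qprod c r s m"
   
  proof -
    have "q ^ m + z * q ^ (m + i) = q ^ m * (1 + fps_const c * fps_X ^ (r + s * i))" for i
      by (simp add: q_def z_def power_add distrib_left mult_ac flip: power_mult)
    then show ?thesis
      by (simp add: qprod_def prod.distrib power2_eq_square flip: power_mult)
  qed
  also have "(\<Prod>i<m. q ^ m + z * q ^ i) = z ^ m * q ^ (m choose 2) * qprod c (s - r) s m"
   
  proof -
    have "z * q ^ i * (1 + fps_const c * fps_X ^ (s - r + s * (m - Suc i))) = q ^ m + z * q ^ i" if "i < m" for i
    proof -
      from that obtain d where d: "m = Suc i + d"
        by (metis Suc_leI le_Suc_ex)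
      have "fps_const c * fps_X ^ r * fps_X ^ (s * i) * (fps_const c * fps_X ^ (s - r + s * d)) =
          (fps_const c * fps_const c) * fps_X ^ (r + s * i + (s - r + s * d))"
        unfolding power_add by (simp only: mult_ac)
      also have "r + s * i + (s - r + s * d) = s * m"
        using rs d by (simp add: algebra_simps)
      finally have "fps_const c * fps_X ^ r * fps_X ^ (s * i) * (fps_const c * fps_X ^ (s - r + s * d)) = fps_X ^ (s * m)"
        by (simp only: cc mult_1_left)
      moreover have "m - Suc i = d"
        using d by simp
      ultimately show ?thesis
        by (simp only: q_def z_def distrib_left mult_1_right power_mult add.commute)
    qed
    then have "(\<Prod>i<m. q ^ m + z * q ^ i) = (\<Prod>i<m. z * q ^ i) * (\<Prod>i<m. 1 + fps_const c * fps_X ^ (s - r + s * (m - Suc i)))"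
      by (simp flip: prod.distrib)
    then show ?thesis
      unfolding prod_mult_power_choose qprod_def
      by (simp only: prod.nat_diff_reindex[of "\<lambda>i. 1 + fps_const c * fps_X ^ (s - r + s * i)"])
  qed
  finally have L0: "(\<Prod>i<2*m. q ^ m + z * q ^ i) = z ^ m * q ^ (m choose 2) * qprod c (s - r) s m * (q ^ (m\<^sup>2) * qprod c r s m)" .
  have L: "(\<Prod>i<2*m. q ^ m + z * q ^ i) = fps_const (c ^ m) * fps_X ^ K * (qprod c r s m * qprod c (s - r) s m)"
   
  proof -
    have "fps_const (c ^ m) * fps_X ^ K = z ^ m * q ^ (m choose 2) * q ^ (m\<^sup>2)"
      unfolding K_def z_def q_def power_mult_distrib power_add fps_const_power power_mult [symmetric]
      by (simp only: mult_ac)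
    then show ?thesis
      unfolding L0 by (simp only: mult_ac)
  qed
  define S where "S = (\<Sum>n=-int m..int m. (qbinom q (2 * m) (nat (int m + n)) * fps_const (c ^ nat \<bar>n\<bar>))
       * fps_X ^ nat (int r * n + int s * (n * (n - 1) div 2)))"
  have "(\<Prod>i<2*m. q ^ m + z * q ^ i) = (\<Sum>k\<le>2*m. qbinom q (2*m) k * q ^ (k choose 2) * z ^ k * (q ^ m) ^ (2 * m - k))"
    by (rule qbinomial_theorem)
  also have "\<dots> = (\<Sum>n=-int m..int m. qbinom q (2*m) (nat (int m + n)) * q ^ (nat (int m + n) choose 2) * z ^ nat (int m + n) * (q ^ m) ^ (2 * m - nat (int m + n)))"
    by (rule sum.reindex_bij_witness[of _ "\<lambda>n. nat (int m + n)" "\<lambda>k. int k - int m"]) auto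
  also have "\<dots> = fps_const (c ^ m) * fps_X ^ K * S"
    unfolding S_def sum_distrib_left
  proof (intro sum.cong refl)
    fix n assume n: "n \<in> {-int m..int m}"
    show "qbinom q (2*m) (nat (int m + n)) * q ^ (nat (int m + n) choose 2) * z ^ nat (int m + n) * (q ^ m) ^ (2 * m - nat (int m + n))
      = fps_const (c ^ m) * fps_X ^ K * ((qbinom q (2 * m) (nat (int m + n)) * fps_const (c ^ nat \<bar>n\<bar>))
       * fps_X ^ nat (int r * n + int s * (n * (n - 1) div 2)))"
    proof -
      define k where "k = nat (int m + n)"
      have k: "int k = int m + n" "k \<le> 2 * m"
        using n by (auto simp: k_def)
      have sgn: "c ^ k = c ^ m * c ^ nat \<bar>n\<bar>"
      proof -
        have "even k \<longleftrightarrow> even (m + nat \<bar>n\<bar>)"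
          using arg_cong[OF k(1), of even] by (simp add: even_nat_iff)
        then show ?thesis
          using c by (auto simp: minus_one_power_iff even_nat_iff split: if_splits)
      qed
      define t where "t = n * (n - 1) div 2"
      have t: "2 * t = n * (n - 1)"
        unfolding t_def by (rule two_mult_half_pred)
      define e where "e = int r * n + int s * t"
      have e0: "e \<ge> 0"
        unfolding e_def t_def by (rule jtp_exponent_nonneg[OF rs])
      have "2 * int (s * (k choose 2) + r * k + s * m * (2 * m - k)) =
          int s * (2 * int (k choose 2)) + 2 * int r * int k + 2 * int s * int m * (2 * int m - int k)"
        unfolding of_nat_add of_nat_mult of_nat_diff[OF k(2)] by (simp add: algebra_simps)
      also have "\<dots> = 2 * (int s * int m ^ 2 + int r * int m) + int s * (2 * int (m choose 2)) + 2 * int r * n + int s * (2 * t)"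
        unfolding int_choose_two t k(1) by (simp add: algebra_simps power2_eq_square)
      also have "\<dots> = 2 * int (K + nat e)"
        using e0 by (simp add: K_def e_def algebra_simps)
      finally have exps: "s * (k choose 2) + r * k + s * m * (2 * m - k) = K + nat e"
        by (simp only: mult_cancel_left of_nat_eq_iff) simp
      have "qbinom q (2*m) k * q ^ (k choose 2) * z ^ k * (q ^ m) ^ (2 * m - k) =
         qbinom q (2*m) k * fps_const (c ^ k) * fps_X ^ (s * (k choose 2) + r * k + s * m * (2 * m - k))"
        unfolding z_def q_def power_mult_distrib power_add fps_const_power power_mult [symmetric]
        by (simp only: mult_ac)
      also have "\<dots> = qbinom q (2*m) k * fps_const (c ^ m * c ^ nat \<bar>n\<bar>) * fps_X ^ (K + nat e)"
        unfolding exps sgn ..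
      finally show ?thesis
        unfolding k_def [symmetric] t_def [symmetric] e_def [symmetric]
        by (simp add: power_add mult_ac flip: fps_const_mult)
    qed
  qed
  finally have "fps_const (c ^ m) * fps_X ^ K * (qprod c r s m * qprod c (s - r) s m) = fps_const (c ^ m) * fps_X ^ K * S"
    unfolding L .
  moreover have "fps_const (c ^ m) * fps_X ^ K \<noteq> (0 :: int fps)"
    using c by auto
  ultimately show ?thesis
    unfolding S_def q_def using c by auto
qed

text \<open>The limit of the finite form: for fixed n the central binomials times
  \<open>eu s\<close> tend to 1. Only z = c q^r with a sign c occurs, so series in one variable
  suffice.\<close>

theorem jacobi_triple_product:
  assumes c: "c = 1 \<or> c = -1" and rs: "r \<le> s" "s > 0"
  defines "e \<equiv> \<lambda>n. int r * n + int s * (n * (n - 1) div 2)"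
  shows "qprod_inf c r s * qprod_inf c (s - r) s * eu s = iseries UNIV e (\<lambda>n. c ^ nat \<bar>n\<bar>)"
    and "admissible I e"
proof -
  show adm: "admissible I e" for I
    by (rule admissibleI_abs[of _ 1]) (simp_all add: e_def jtp_exponent_bound jtp_exponent_nonneg rs)
  have "(\<lambda>m. qprod c r s m * qprod c (s - r) s m * eu s) \<longlonglongrightarrow> iseries UNIV e (\<lambda>n. c ^ nat \<bar>n\<bar>)"
   
  proof -
    have "(\<lambda>m. \<Sum>n=-int m..int m. (qbinom (fps_X ^ s) (2 * m) (nat (int m + n)) * eu s * fps_const (c ^ nat \<bar>n\<bar>)) * fps_X ^ nat (e n))
       \<longlonglongrightarrow> iseries UNIV e (\<lambda>n. c ^ nat \<bar>n\<bar>)"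
    proof (rule tendsto_iseries[OF adm])
      fix n :: int
      show "\<forall>\<^sub>F m in sequentially. n \<in> {- int m..int m}"
        using eventually_ge_at_top[of "nat \<bar>n\<bar>"] by eventually_elim auto
      have ev: "\<forall>\<^sub>F m in sequentially. nat (int m + n) \<le> 2 * m \<and> nat (int m - n) = 2 * m - nat (int m + n)"
        using eventually_ge_at_top[of "nat \<bar>n\<bar>"] by eventually_elim auto
      have lim: "filterlim (\<lambda>m. nat (int m + k)) at_top sequentially" for k
        unfolding filterlim_at_top
      proof
        fix Z
        show "\<forall>\<^sub>F m in sequentially. Z \<le> nat (int m + k)"
          using eventually_ge_at_top[of "Z + nat \<bar>k\<bar>"] by eventually_elim auto
      qed
      have "(\<lambda>m. qbinom (fps_X ^ s) (2 * m) (nat (int m + n)) * eu s * fps_const (c ^ nat \<bar>n\<bar>)) \<longlonglongrightarrow> 1 * fps_const (c ^ nat \<bar>n\<bar>)"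
        by (intro tendsto_mult_fps qbinom_eu_tendsto[OF rs(2) lim _ ev] tendsto_const)
          (use lim[of "-n"] in simp)
      then show "(\<lambda>m. qbinom (fps_X ^ s) (2 * m) (nat (int m + n)) * eu s * fps_const (c ^ nat \<bar>n\<bar>)) \<longlonglongrightarrow> fps_const (c ^ nat \<bar>n\<bar>)"
        by simp
    qed auto
    then show ?thesis
      unfolding jacobi_triple_product_finite[OF c rs(1)] e_def sum_distrib_right
      by (simp only: mult_ac)
  qed
  moreover have "(\<lambda>m. qprod c r s m * qprod c (s - r) s m * eu s) \<longlonglongrightarrow> qprod_inf c r s * qprod_inf c (s - r) s * eu s"
    by (intro tendsto_mult_fps qprod_tendsto tendsto_const rs)
  ultimately show "qprod_inf c r s * qprod_inf c (s - r) s * eu s = iseries UNIV e (\<lambda>n. c ^ nat \<bar>n\<bar>)"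
    using LIMSEQ_unique by blast
qed

subsection \<open>Jacobi's identity for the cube of the Euler product\<close>

definition sg :: "int \<Rightarrow> int" where
  "sg n = (if even n then 1 else -1)"

lemma sg_minus [simp]: "sg (- n) = sg n"
  by (simp add: sg_def)

lemma minus_one_power_abs: "(-1) ^ nat \<bar>n\<bar> = sg n"
  by (simp add: sg_def minus_one_power_iff even_nat_iff)

text \<open>Pascal's recursion is not visibly symmetric, but the product formula is; for q = X^r the
  q-factorials are nonzero and cancel.\<close>

lemma qbinom_symmetric:
  assumes "r > 0" "k \<le> n"
  shows "qbinom (fps_X ^ r :: int fps) n (n - k) = qbinom (fps_X ^ r) n k"
proof -
  define P where "P = qprod (-1) r r"
  have P: "P n = (\<Prod>i<n. 1 - (fps_X ^ r) ^ Suc i)" for n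
    by (simp add: P_def qprod_eu)
  have "fps_nth (P n) 0 = 1" for n
    using fps_nth_qprod[of r 0 1 "Suc n" "-1" r] assms(1) unfolding P_def
    by (induction n) (auto simp: qprod_Suc)
  then have [simp]: "P n \<noteq> 0" for n
    by (metis fps_zero_nth zero_neq_one)
  have "qbinom (fps_X ^ r) n k * P k * P (n - k) = P n"
    using qbinom_fact[OF assms(2), of "fps_X ^ r :: int fps"] by (simp only: P)
  moreover have "qbinom (fps_X ^ r) n (n - k) * P (n - k) * P k = P n"
    using qbinom_fact[of "n - k" n "fps_X ^ r :: int fps"] assms(2) by (simp add: P)
  ultimately have "qbinom (fps_X ^ r) n (n - k) * (P (n - k) * P k) = qbinom (fps_X ^ r) n k * (P (n - k) * P k)"
    by (simp add: mult_ac)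
  then show ?thesis
    by simp
qed

text \<open>The values at x = -1 of the factors below and above the middle one in the product of
  \<open>qbinomial_theorem_deriv\<close>.\<close>

lemma prod_without_middle:
  fixes q :: "'a::comm_ring_1"
  shows "(\<Prod>i<m. q ^ m - q ^ i) = (-1) ^ m * q ^ (m choose 2) * (\<Prod>i<m. 1 - q ^ Suc i)"
    and "(\<Prod>i<m. q ^ m - q ^ (m + Suc i)) = q ^ (m\<^sup>2) * (\<Prod>i<m. 1 - q ^ Suc i)"
proof -
  have "q ^ m - q ^ i = (-1) * q ^ i * (1 - q ^ Suc (m - Suc i))" if "i < m" for i
  proof -
    from that have "m = i + Suc (m - Suc i)" by simp
    then have "q ^ m = q ^ i * q ^ Suc (m - Suc i)"
      by (metis power_add)
    then show ?thesis
      by (simp add: algebra_simps)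
  qed
  then have "(\<Prod>i<m. q ^ m - q ^ i) = (\<Prod>i<m. (-1) * q ^ i) * (\<Prod>i<m. 1 - q ^ Suc (m - Suc i))"
    by (simp flip: prod.distrib)
  then show "(\<Prod>i<m. q ^ m - q ^ i) = (-1) ^ m * q ^ (m choose 2) * (\<Prod>i<m. 1 - q ^ Suc i)"
    unfolding prod_mult_power_choose prod.nat_diff_reindex[of "\<lambda>i. 1 - q ^ Suc i"] .
  have "q ^ m - q ^ (m + Suc i) = q ^ m * (1 - q ^ Suc i)" for i
    by (simp only: power_add right_diff_distrib mult_1_right)
  then show "(\<Prod>i<m. q ^ m - q ^ (m + Suc i)) = q ^ (m\<^sup>2) * (\<Prod>i<m. 1 - q ^ Suc i)"
    by (simp add: prod.distrib power2_eq_square flip: power_mult)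
qed

text \<open>Lets \<open>qbinomial_theorem_deriv\<close>, which identifies polynomials with their
  functions, be applied with coefficients in \<open>int fps\<close>.\<close>

instance fps :: (ring_char_0) ring_char_0 ..

lemma pderiv_sum: "pderiv (sum f A) = (\<Sum>i\<in>A. pderiv (f i))"
  by (induction A rule: infinite_finite_induct) (simp_all add: pderiv_add)

text \<open>The factor with \<open>i = m\<close> of \<open>\<Prod>i<2*m+1. q ^ m + x * q ^ i\<close> vanishes at \<open>x = -1\<close>, so the derivative of the
  q-binomial theorem there is the product of the other factors.\<close>

lemma qbinomial_theorem_deriv:
  fixes q :: "'a::{idom,ring_char_0}"
  shows "(\<Sum>k\<le>2*m+1. of_nat k * (qbinom q (2*m+1) k * q ^ (k choose 2) * (q ^ m) ^ (2*m+1-k)) * (-1) ^ (k - 1))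
    = (-1) ^ m * q ^ (m + (m choose 2) + m\<^sup>2) * (\<Prod>i<m. 1 - q ^ Suc i)\<^sup>2"
proof -
  define F where "F = (\<lambda>i. [:q ^ m, q ^ i:])"
  define G where "G = (\<Prod>i<m. F i) * (\<Prod>i<m. F (m + Suc i))"
  define R where "R = (\<Sum>k\<le>2*m+1. monom (qbinom q (2*m+1) k * q ^ (k choose 2) * (q ^ m) ^ (2*m+1-k)) k)"
  have "poly (\<Prod>i<2*m+1. F i) = poly R"
  proof
    fix x
    have "poly (\<Prod>i<2*m+1. F i) x = (\<Prod>i<2*m+1. q ^ m + x * q ^ i)"
      unfolding poly_prod by (intro prod.cong) (simp_all add: F_def)
    then show "poly (\<Prod>i<2*m+1. F i) x = poly R x"
      unfolding qbinomial_theorem by (simp add: R_def poly_sum poly_monom mult_ac)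
  qed
  moreover have "2 * m + 1 = m + Suc m"
    by simp
  ultimately have "R = (\<Prod>i<m + Suc m. F i)"
    unfolding poly_eq_poly_eq_iff by metis
  also have "\<dots> = F m * G"
    unfolding prod_lessThan_add prod.lessThan_Suc_shift by (simp add: G_def mult_ac)
  finally have "poly (pderiv R) (-1) = poly (pderiv (F m * G)) (-1)"
    by simp
  moreover have "poly (pderiv (F m * G)) (-1) = q ^ m * poly G (-1)"
    unfolding pderiv_mult poly_add poly_mult by (simp add: F_def pderiv_pCons)
  moreover have "poly G (-1) = (\<Prod>i<m. q ^ m - q ^ i) * (\<Prod>i<m. q ^ m - q ^ (m + Suc i))"
    by (simp add: G_def F_def poly_prod)
  moreover have "poly (pderiv R) (-1) = (\<Sum>k\<le>2*m+1. of_nat k * (qbinom q (2*m+1) k * q ^ (k choose 2) * (q ^ m) ^ (2*m+1-k)) * (-1) ^ (k - 1))"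
    unfolding R_def pderiv_sum poly_sum pderiv_monom poly_monom by (simp add: mult_ac)
  ultimately show ?thesis
    unfolding prod_without_middle by (simp add: power2_eq_square power_add mult_ac)
qed

text \<open>Differentiation produces the weight m + 1 + n, which has no limit as m grows. The
  reflection n to -1 - n turns it into n - m, and adding both versions gives 2 n + 1, free of m, at
  the price of the factor 2.\<close>

lemma jacobi_cube_finite:
  assumes "r > 0"
  shows "2 * (qprod (-1) r r m)\<^sup>2 =
    (\<Sum>n=-int m - 1..int m. (qbinom (fps_X ^ r) (2 * m + 1) (nat (int m + 1 + n)) * fps_const (sg n * (2 * n + 1)))
       * fps_X ^ nat (int r * (n * (n + 1) div 2)))"
proof -
  define q where "q = (fps_X ^ r :: int fps)"
  define K where "K = m + (m choose 2) + m\<^sup>2"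
  define B where "B = (\<lambda>n. qbinom q (2 * m + 1) (nat (int m + 1 + n)))"
  define T where "T = (\<lambda>n. nat (n * (n + 1) div 2))"
  define J where "J = {-int m - 1..int m}"
  have "qprod (-1) r r m = (\<Prod>i<m. 1 - q ^ Suc i)"
    by (simp add: qprod_eu q_def)
  then have "(-1) ^ m * q ^ K * (qprod (-1) r r m)\<^sup>2 =
     (\<Sum>k\<le>2*m+1. of_nat k * (qbinom q (2*m+1) k * q ^ (k choose 2) * (q ^ m) ^ (2*m+1-k)) * (-1) ^ (k - 1))"
    by (simp only: qbinomial_theorem_deriv K_def)
  also have "\<dots> = (\<Sum>n\<in>J. of_nat (nat (int m + 1 + n)) * (qbinom q (2*m+1) (nat (int m + 1 + n)) * q ^ (nat (int m + 1 + n) choose 2) * (q ^ m) ^ (2*m+1-nat (int m + 1 + n))) * (-1) ^ (nat (int m + 1 + n) - 1))"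
    unfolding J_def by (rule sum.reindex_bij_witness[of _ "\<lambda>n. nat (int m + 1 + n)" "\<lambda>k. int k - int m - 1"]) auto
  also have "\<dots> = (\<Sum>n\<in>J. (-1) ^ m * q ^ K * (of_int (sg n * (int m + 1 + n)) * B n * q ^ T n))"
  proof (intro sum.cong refl)
    fix n assume n: "n \<in> J"
    define k where "k = nat (int m + 1 + n)"
    have k: "int k = int m + 1 + n" "k \<le> 2 * m + 1"
      using n by (auto simp: k_def J_def)
    have sgn: "of_nat k * (-1) ^ (k - 1) = (-1) ^ m * (of_int (sg n * (int m + 1 + n)) :: int fps)"
    proof (cases k)
      case 0
      with k show ?thesis by simp
    next
      case (Suc j)
      then have "even j \<longleftrightarrow> even (int m + n)"
        using k(1) by (metis add.commute add.left_commute add_left_cancel even_of_nat of_nat_Suc)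
      then have "(-1) ^ j = (-1) ^ m * (of_int (sg n) :: int fps)"
        by (auto simp: sg_def minus_one_power_iff)
      moreover have "of_nat k = (of_int (int m + 1 + n) :: int fps)"
        unfolding k(1) [symmetric] by simp
      ultimately show ?thesis
        using Suc by (simp del: of_nat_Suc add: mult_ac)
    qed
    define t where "t = n * (n + 1) div 2"
    have t: "2 * t = n * (n + 1)"
      by (simp add: t_def)
    have "0 \<le> n * (n + 1)"
      by (cases "n \<ge> 0") (auto intro: mult_nonpos_nonpos)
    then have t0: "int (T n) = t"
      using t by (simp add: T_def flip: t_def)
    have "2 * int ((k choose 2) + m * (2 * m + 1 - k)) = 2 * int (k choose 2) + 2 * int m * (2 * int m + 1 - int k)"
      unfolding of_nat_add of_nat_mult of_nat_diff[OF k(2)] by (simp add: algebra_simps)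
    also have "\<dots> = 2 * int m + 2 * int (m choose 2) + 2 * int m ^ 2 + 2 * t"
      unfolding int_choose_two t k(1) by (simp add: algebra_simps power2_eq_square)
    also have "\<dots> = 2 * int (K + T n)"
      by (simp add: K_def t0)
    finally have exps: "(k choose 2) + m * (2 * m + 1 - k) = K + T n"
      by (simp only: mult_cancel_left of_nat_eq_iff) simp
    have "of_nat k * (qbinom q (2*m+1) k * q ^ (k choose 2) * (q ^ m) ^ (2*m+1-k)) * (-1) ^ (k - 1)
        = (of_nat k * (-1) ^ (k - 1)) * qbinom q (2*m+1) k * q ^ ((k choose 2) + m * (2 * m + 1 - k))"
      unfolding power_add power_mult by (simp only: mult_ac)
    also have "\<dots> = (-1) ^ m * q ^ K * (of_int (sg n * (int m + 1 + n)) * B n * q ^ T n)"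
      unfolding sgn exps power_add B_def k_def [symmetric] by (simp only: mult_ac)
    finally show "of_nat (nat (int m + 1 + n)) * (qbinom q (2*m+1) (nat (int m + 1 + n)) * q ^ (nat (int m + 1 + n) choose 2) * (q ^ m) ^ (2*m+1-nat (int m + 1 + n))) * (-1) ^ (nat (int m + 1 + n) - 1)
       = (-1) ^ m * q ^ K * (of_int (sg n * (int m + 1 + n)) * B n * q ^ T n)"
      unfolding k_def .
  qed
  also have "\<dots> = (-1) ^ m * q ^ K * (\<Sum>n\<in>J. of_int (sg n * (int m + 1 + n)) * B n * q ^ T n)"
    by (rule sum_distrib_left [symmetric])
  finally have S: "(qprod (-1) r r m)\<^sup>2 = (\<Sum>n\<in>J. of_int (sg n * (int m + 1 + n)) * B n * q ^ T n)"
    by (simp add: q_def)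
  also have "\<dots> = (\<Sum>n\<in>J. of_int (sg n * (n - int m)) * B n * q ^ T n)"
  proof (rule sum.reindex_bij_witness[of _ "\<lambda>n. - 1 - n" "\<lambda>n. - 1 - n"])
    fix n assume n: "n \<in> J"
    have k: "nat (int m + 1 + (- 1 - n)) = 2 * m + 1 - nat (int m + 1 + n)" "nat (int m + 1 + n) \<le> 2 * m + 1"
      using n by (auto simp: J_def)
    have "B (- 1 - n) = B n"
      unfolding B_def q_def k(1) by (rule qbinom_symmetric[OF assms k(2)])
    moreover have "T (- 1 - n) = T n"
      by (simp add: T_def algebra_simps)
    moreover have "sg (- 1 - n) = - sg n"
      by (simp add: sg_def)
    ultimately show "of_int (sg (- 1 - n) * (- 1 - n - int m)) * B (- 1 - n) * q ^ T (- 1 - n) =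
       of_int (sg n * (int m + 1 + n)) * B n * q ^ T n"
      by (simp add: algebra_simps)
  qed (auto simp: J_def)
  finally have "2 * (qprod (-1) r r m)\<^sup>2 = (\<Sum>n\<in>J. of_int (sg n * (int m + 1 + n)) * B n * q ^ T n) + (\<Sum>n\<in>J. of_int (sg n * (n - int m)) * B n * q ^ T n)"
    using S by simp
  also have "\<dots> = (\<Sum>n\<in>J. (B n * fps_const (sg n * (2 * n + 1))) * fps_X ^ nat (int r * (n * (n + 1) div 2)))"
    unfolding sum.distrib [symmetric]
  proof (intro sum.cong refl)
    fix n
    have "q ^ T n = fps_X ^ nat (int r * (n * (n + 1) div 2))"
      by (simp add: q_def T_def nat_mult_distrib flip: power_mult)
    moreover have "fps_const (sg n * (2 * n + 1)) = of_int (sg n * (int m + 1 + n)) + of_int (sg n * (n - int m))"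
      by (simp add: fps_of_int [symmetric] algebra_simps)
    ultimately show "of_int (sg n * (int m + 1 + n)) * B n * q ^ T n + of_int (sg n * (n - int m)) * B n * q ^ T n
      = (B n * fps_const (sg n * (2 * n + 1))) * fps_X ^ nat (int r * (n * (n + 1) div 2))"
      by (simp only: distrib_left distrib_right mult_ac)
  qed
  finally show ?thesis
    unfolding B_def J_def q_def .
qed

lemma admissible_triangular:
  assumes "k > 0"
  shows "admissible I (\<lambda>n. k * (n * (n + 1) div 2))"
proof (rule admissibleI_abs[of _ 1])
  fix n :: int
  define t where "t = n * (n + 1) div 2"
  have t: "2 * t = n * (n + 1)"
    by (simp add: t_def)
  have "0 \<le> n * (n + 1)"
    by (cases "n \<ge> 0") (auto intro: mult_nonpos_nonpos)
  with t have t0: "0 \<le> t"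
    by simp
  with assms show "0 \<le> k * (n * (n + 1) div 2)"
    by (simp flip: t_def)
  have "0 \<le> n * (n - 1)"
    by (cases "n > 0") (auto intro: mult_nonpos_nonpos)
  moreover have "0 \<le> (n + 1) * (n + 2)"
    by (cases "n \<ge> -1"; cases "n = -1") (auto intro: mult_nonpos_nonpos)
  ultimately have "\<bar>n\<bar> \<le> t + 1"
    using t by (simp add: algebra_simps abs_if)
  also have "t \<le> k * t"
    using assms t0 mult_right_mono[of 1 k t] by simp
  finally show "\<bar>n\<bar> \<le> k * (n * (n + 1) div 2) + 1"
    by (simp flip: t_def)
qed

text \<open>The factor 2 arises because n and -1 - n contribute equal terms, so the sum over all
  integers counts the classical sum over n >= 0 twice.\<close>

theorem jacobi_cube:
  assumes r: "r > 0"
  shows "2 * eu r ^ 3 = iseries UNIV (\<lambda>n. int r * (n * (n + 1) div 2)) (\<lambda>n. sg n * (2 * n + 1))"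
    (is "_ = iseries UNIV ?e ?c")
proof -
  have "(\<lambda>m. \<Sum>n=-int m-1..int m. (qbinom (fps_X ^ r) (2 * m + 1) (nat (int m + 1 + n)) * eu r * fps_const (?c n)) * fps_X ^ nat (?e n))
       \<longlonglongrightarrow> iseries UNIV ?e ?c"
  proof (rule tendsto_iseries)
    show "admissible UNIV ?e"
      using r by (intro admissible_triangular) simp
    fix n :: int
    show "\<forall>\<^sub>F m in sequentially. n \<in> {- int m - 1..int m}"
      using eventually_ge_at_top[of "nat \<bar>n\<bar>"] by eventually_elim auto
    have ev: "\<forall>\<^sub>F m in sequentially. nat (int m + 1 + n) \<le> 2 * m + 1 \<and> nat (int m - n) = 2 * m + 1 - nat (int m + 1 + n)"
      using eventually_ge_at_top[of "nat \<bar>n\<bar>"] by eventually_elim auto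
    have lim: "filterlim (\<lambda>m. nat (int m + k)) at_top sequentially" for k
      unfolding filterlim_at_top
    proof
      fix Z
      show "\<forall>\<^sub>F m in sequentially. Z \<le> nat (int m + k)"
        using eventually_ge_at_top[of "Z + nat \<bar>k\<bar>"] by eventually_elim auto
    qed
    have "(\<lambda>m. qbinom (fps_X ^ r) (2 * m + 1) (nat (int m + 1 + n)) * eu r * fps_const (?c n)) \<longlonglongrightarrow> 1 * fps_const (?c n)"
      by (intro tendsto_mult_fps qbinom_eu_tendsto[OF r _ _ ev] tendsto_const)
        (use lim[of "-n"] lim[of "1 + n"] in \<open>simp_all add: add.assoc\<close>)
    then show "(\<lambda>m. qbinom (fps_X ^ r) (2 * m + 1) (nat (int m + 1 + n)) * eu r * fps_const (?c n)) \<longlonglongrightarrow> fps_const (?c n)"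
      by simp
  qed auto
  then have "(\<lambda>m. 2 * (qprod (-1) r r m)\<^sup>2 * eu r) \<longlonglongrightarrow> iseries UNIV ?e ?c"
    unfolding jacobi_cube_finite[OF r] sum_distrib_right by (simp only: mult_ac)
  moreover have "(\<lambda>m. 2 * (qprod (-1) r r m)\<^sup>2 * eu r) \<longlonglongrightarrow> 2 * (eu r)\<^sup>2 * eu r"
    by (intro tendsto_mult_fps tendsto_power_fps eu_tendsto tendsto_const r)
  ultimately have "2 * (eu r)\<^sup>2 * eu r = iseries UNIV ?e ?c"
    using LIMSEQ_unique by blast
  then show ?thesis
    by (simp add: power2_eq_square power3_eq_cube mult.assoc)
qed

subsection \<open>Algebra of indexed series\<close>

lemma iseries_reindex:
  assumes "\<And>j. j \<in> J \<Longrightarrow> g j \<in> I \<and> h (g j) = j \<and> e (g j) = e' j \<and> c (g j) = c' j"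
    and "\<And>i. i \<in> I \<Longrightarrow> h i \<in> J \<and> g (h i) = i"
  shows "iseries I e c = iseries J e' c'"
proof (rule fps_ext)
  fix n
  show "fps_nth (iseries I e c) n = fps_nth (iseries J e' c') n"
    unfolding iseries_nth
    by (rule sum.reindex_bij_witness[of _ g h]) (use assms in force)+
qed

lemma iseries_cong:
  assumes "\<And>i. i \<in> I \<Longrightarrow> e i = e' i \<and> c i = c' i"
  shows "iseries I e c = iseries I e' c'"
  by (rule iseries_reindex[of _ id _ id]) (use assms in auto)

lemma iseries_const_mult: "fps_const k * iseries I e c = iseries I e (\<lambda>i. k * c i)"
  by (rule fps_ext) (simp add: iseries_nth sum_distrib_left)

lemma iseries_add: "iseries I e c + iseries I e d = iseries I e (\<lambda>i. c i + d i)"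
  by (rule fps_ext) (simp add: iseries_nth sum.distrib)

lemma iseries_diff: "iseries I e c - iseries I e d = iseries I e (\<lambda>i. c i - d i)"
  by (rule fps_ext) (simp add: iseries_nth sum_subtractf)

lemma iseries_uminus: "- iseries I e c = iseries I e (\<lambda>i. - c i)"
  by (rule fps_ext) (simp add: iseries_nth sum_negf)

lemma iseries_Un:
  assumes "admissible (I \<union> J) e" "I \<inter> J = {}"
  shows "iseries (I \<union> J) e c = iseries I e c + iseries J e c"
proof (rule fps_ext)
  fix n
  have "{i \<in> I \<union> J. e i = int n} = {i \<in> I. e i = int n} \<union> {i \<in> J. e i = int n}"
    by auto
  moreover have "finite {i \<in> I. e i = int n}" "finite {i \<in> J. e i = int n}"
    by (rule admissible_fibre[OF admissible_subset[OF assms(1)]]; simp)+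
  ultimately show "fps_nth (iseries (I \<union> J) e c) n = fps_nth (iseries I e c + iseries J e c) n"
    unfolding iseries_nth fps_add_nth using assms(2) by (simp add: sum.union_disjoint disjoint_iff)
qed

text \<open>Sign-reversing involution; the series equals its negative, and a fixed point has
  coefficient 0.\<close>

lemma iseries_eq_0_involution:
  assumes "\<And>i. i \<in> I \<Longrightarrow> h i \<in> I \<and> h (h i) = i \<and> e (h i) = e i \<and> c (h i) = - c i"
  shows "iseries I e c = 0"
proof -
  have "iseries I e c = iseries I e (\<lambda>i. - c i)"
    by (rule iseries_reindex[of _ h _ h]) (use assms in auto)
  then have "iseries I e c = - iseries I e c"
    by (simp add: iseries_uminus)
  then show ?thesis
    by (simp add: eq_neg_iff_add_eq_0)
qed

lemma admissible_Times:
  assumes "admissible I e" "admissible J f"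
  shows "admissible (I \<times> J) (\<lambda>(i, j). e i + f j)"
  unfolding admissible_def
proof (intro conjI allI ballI)
  fix n
  have "{p \<in> I \<times> J. (case p of (i, j) \<Rightarrow> e i + f j) \<le> n} \<subseteq> {i \<in> I. e i \<le> n} \<times> {j \<in> J. f j \<le> n}"
    using assms unfolding admissible_def by fastforce
  moreover have "finite \<dots>"
    using assms unfolding admissible_def by blast
  ultimately show "finite {p \<in> I \<times> J. (case p of (i, j) \<Rightarrow> e i + f j) \<le> n}"
    by (rule finite_subset)
qed (use assms in \<open>auto simp: admissible_def\<close>)

lemma iseries_mult:
  assumes "admissible I e" "admissible J f"
  shows "iseries I e c * iseries J f d = iseries (I \<times> J) (\<lambda>(i, j). e i + f j) (\<lambda>(i, j). c i * d j)"
proof (rule fps_ext)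
  fix n
  define A where "A = (\<lambda>k. {i \<in> I. e i = int k})"
  define B where "B = (\<lambda>k. {j \<in> J. f j = int k})"
  have fin: "finite (A k)" "finite (B k)" for k
    unfolding A_def B_def by (rule admissible_fibre[OF assms(1)], rule admissible_fibre[OF assms(2)])
  have pos: "0 \<le> e i" "0 \<le> f j" if "i \<in> I" "j \<in> J" for i j
    using assms that by (auto simp: admissible_def)
  have U: "{p \<in> I \<times> J. (case p of (i, j) \<Rightarrow> e i + f j) = int n} = (\<Union>k\<in>{0..n}. A k \<times> B (n - k))"
  proof (intro equalityI subsetI)
    fix p assume p: "p \<in> {p \<in> I \<times> J. (case p of (i, j) \<Rightarrow> e i + f j) = int n}"
    then obtain i j where ij: "p = (i, j)" "i \<in> I" "j \<in> J" "e i + f j = int n"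
      by auto
    then have "i \<in> A (nat (e i))" "j \<in> B (n - nat (e i))" "nat (e i) \<le> n"
      using pos[OF ij(2,3)] by (auto simp: A_def B_def nat_le_iff of_nat_diff)
    then show "p \<in> (\<Union>k\<in>{0..n}. A k \<times> B (n - k))"
      using ij(1) by auto
  qed (auto simp: A_def B_def of_nat_diff)
  have "fps_nth (iseries I e c * iseries J f d) n = (\<Sum>k=0..n. (\<Sum>i\<in>A k. c i) * (\<Sum>j\<in>B (n - k). d j))"
    by (simp add: fps_mult_nth iseries_nth A_def B_def)
  also have "\<dots> = (\<Sum>k=0..n. \<Sum>(i, j)\<in>A k \<times> B (n - k). c i * d j)"
    by (simp add: sum_product sum.cartesian_product)
  also have "\<dots> = (\<Sum>(i, j)\<in>(\<Union>k\<in>{0..n}. A k \<times> B (n - k)). c i * d j)"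
    by (rule sum.UNION_disjoint [symmetric]) (use fin in \<open>auto simp: A_def B_def intro!: finite_cartesian_product simp del: of_nat_diff\<close>)
  finally show "fps_nth (iseries I e c * iseries J f d) n = fps_nth (iseries (I \<times> J) (\<lambda>(i, j). e i + f j) (\<lambda>(i, j). c i * d j)) n"
    unfolding iseries_nth U .
qed

text \<open>The operator q d/dq, from which the Wronskians below are built.\<close>

lemma iseries_theta: "fps_X * fps_deriv (iseries I e c) = iseries I e (\<lambda>i. e i * c i)"
proof (rule fps_ext)
  fix n
  have "(\<Sum>i | i \<in> I \<and> e i = int n. e i * c i) = (\<Sum>i | i \<in> I \<and> e i = int n. int n * c i)"
    by (rule sum.cong) auto
  then show "fps_nth (fps_X * fps_deriv (iseries I e c)) n = fps_nth (iseries I e (\<lambda>i. e i * c i)) n"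
    by (cases n) (simp_all add: iseries_nth sum_distrib_left)
qed

lemma fps_nth_compose_X_power:
  fixes f :: "'a::comm_ring_1 fps"
  assumes "r > 0"
  shows "fps_nth (f oo fps_X ^ r) n = (if r dvd n then fps_nth f (n div r) else 0)"
proof -
  have "fps_nth (f oo fps_X ^ r) n = (\<Sum>i=0..n. if n = r * i then fps_nth f i else 0)"
    unfolding fps_compose_nth by (intro sum.cong refl) (simp flip: power_mult)
  also have "\<dots> = (if r dvd n then fps_nth f (n div r) else 0)"
  proof (cases "r dvd n")
    case True
    then obtain k where k: "n = r * k" ..
    have "(\<Sum>i=0..n. if n = r * i then fps_nth f i else 0) = (\<Sum>i=0..n. if i = k then fps_nth f i else 0)"
      using assms k by (intro sum.cong) auto
    also have "\<dots> = fps_nth f k"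
      using assms k by simp
    finally show ?thesis
      using k assms by simp
  next
    case False
    then have "n \<noteq> r * i" for i
      by auto
    with False show ?thesis
      by simp
  qed
  finally show ?thesis .
qed

lemma iseries_compose_X_power:
  assumes "r > 0"
  shows "iseries I e c oo fps_X ^ r = iseries I (\<lambda>i. int r * e i) c"
proof (rule fps_ext)
  fix n
  show "fps_nth (iseries I e c oo fps_X ^ r) n = fps_nth (iseries I (\<lambda>i. int r * e i) c) n"
  proof (cases "r dvd n")
    case True
    then obtain k where k: "n = r * k" ..
    have "int r * x = int r * int k \<longleftrightarrow> x = int k" for x
      using assms by simp
    with k assms show ?thesis
      by (simp add: fps_nth_compose_X_power iseries_nth)
  next
    case False
    then have "int r * x \<noteq> int n" for x
      by (metis dvd_triv_left int_dvd_int_iff)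
    with False assms show ?thesis
      by (simp add: fps_nth_compose_X_power iseries_nth)
  qed
qed

lemma iseries_compose_uminus_X: "iseries I e c oo - fps_X = iseries I e (\<lambda>i. sg (e i) * c i)"
proof (rule fps_ext)
  fix n
  have "fps_nth ((- fps_X :: int fps) ^ i) n = (if n = i then (-1) ^ i else 0)" for i
    by (subst power_minus) (simp add: minus_one_power_iff)
  then have "fps_nth (iseries I e c oo - fps_X) n = (\<Sum>i=0..n. if n = i then fps_nth (iseries I e c) i * (-1) ^ i else 0)"
    unfolding fps_compose_nth by (intro sum.cong refl) (simp only: if_distrib[of "(*) _"] mult_zero_right)
  also have "\<dots> = (-1) ^ n * fps_nth (iseries I e c) n"
    by simp
  also have "\<dots> = (\<Sum>i | i \<in> I \<and> e i = int n. sg (e i) * c i)"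
    unfolding iseries_nth sum_distrib_left by (intro sum.cong refl) (auto simp: sg_def minus_one_power_iff)
  finally show "fps_nth (iseries I e c oo - fps_X) n = fps_nth (iseries I e (\<lambda>i. sg (e i) * c i)) n"
    by (simp add: iseries_nth)
qed

subsection \<open>Theta functions as Euler products\<close>

lemma qprod_double: "qprod c r s (2 * m) = qprod c r (2 * s) m * qprod c (r + s) (2 * s) m"
  by (induction m) (simp_all add: qprod_Suc algebra_simps)

lemma qprod_inf_double:
  assumes "s > 0"
  shows "qprod_inf c r s = qprod_inf c r (2 * s) * qprod_inf c (r + s) (2 * s)"
proof (rule qprod_inf_eqI[OF assms, of "\<lambda>m. 2 * m"])
  show "filterlim (\<lambda>m::nat. 2 * m) at_top sequentially"
    by (rule mult_nat_left_at_top) simp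
  show "(\<lambda>m. qprod c r s (2 * m)) \<longlonglongrightarrow> qprod_inf c r (2 * s) * qprod_inf c (r + s) (2 * s)"
    unfolding qprod_double using assms by (intro tendsto_mult_fps qprod_tendsto) auto
qed

lemma qprod_inf_pm:
  assumes "s > 0"
  shows "qprod_inf 1 r s * qprod_inf (-1) r s = qprod_inf (-1) (2 * r) (2 * s)"
proof (rule sym, rule qprod_inf_eqI[OF _ filterlim_ident])
  have "qprod (-1) (2 * r) (2 * s) m = qprod 1 r s m * qprod (-1) r s m" for m
  proof -
    have "1 + fps_const (-1) * x ^ 2 = (1 + fps_const 1 * x) * (1 + fps_const (-1) * (x :: int fps))" for x
      by (simp add: algebra_simps power2_eq_square flip: fps_const_neg)
    from this[of "fps_X ^ (r + s * i)" for i]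
    have "1 + fps_const (-1) * fps_X ^ (2 * r + 2 * s * i) =
        (1 + fps_const 1 * fps_X ^ (r + s * i)) * (1 + fps_const (-1) * (fps_X :: int fps) ^ (r + s * i))" for i
      unfolding power_mult [symmetric] by (simp only: distrib_left distrib_right mult_ac)
    then show ?thesis
      unfolding qprod_def prod.distrib [symmetric] by (intro prod.cong refl)
  qed
  then show "(\<lambda>m. qprod (-1) (2 * r) (2 * s) m) \<longlonglongrightarrow> qprod_inf 1 r s * qprod_inf (-1) r s"
    using assms by (simp add: tendsto_mult_fps qprod_tendsto)
qed (use assms in auto)

text \<open>The name \<open>psi2\<close> refers to the classical \<open>\<psi>(q\<^sup>2)\<close>; since the sum runs over all integers
  and not only over the non-negative ones, \<open>psi2\<close> is twice that function.\<close>

definition phi :: "int fps" where "phi = iseries UNIV (\<lambda>n. n\<^sup>2) (\<lambda>_. 1)"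
definition phi_minus :: "int fps" where "phi_minus = iseries UNIV (\<lambda>n. n\<^sup>2) sg"
definition psi2 :: "int fps" where "psi2 = iseries UNIV (\<lambda>n. n\<^sup>2 + n) (\<lambda>_. 1)"

lemma odd_qprod: "qprod_inf (-1) 1 2 * eu 2 = eu 1" "qprod_inf (-1) 2 4 * eu 4 = eu 2"
  using qprod_inf_double[of 1 "-1" 1] qprod_inf_double[of 2 "-1" 2]
    qprod_inf_eu[of 1] qprod_inf_eu[of 2] qprod_inf_eu[of 4]
  by (simp_all del: One_nat_def)

text \<open>The triple product gives \<open>phi\<close> as (-q; q^2)^2 \<open>eu 2\<close>, and
  pairing 1 + x with 1 - x expresses (-q; q^2) by Euler products.\<close>

lemma phi_product: "phi * eu 1 ^ 2 * eu 4 ^ 2 = eu 2 ^ 5"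
proof -
  have "qprod_inf 1 1 2 * qprod_inf 1 1 2 * eu 2 = iseries UNIV (\<lambda>n. int 1 * n + int 2 * (n * (n - 1) div 2)) (\<lambda>n. 1 ^ nat \<bar>n\<bar>)"
    using jacobi_triple_product(1)[of 1 1 2] by simp
  also have "\<dots> = phi"
    unfolding phi_def by (rule iseries_cong) (simp add: power2_eq_square algebra_simps)
  finally have phi: "phi = qprod_inf 1 1 2 ^ 2 * eu 2"
    by (simp add: power2_eq_square)
  have "qprod_inf 1 1 2 * eu 1 * eu 4 = (qprod_inf 1 1 2 * qprod_inf (-1) 1 2) * eu 2 * eu 4"
    unfolding odd_qprod(1) [symmetric] by (simp only: mult_ac)
  also have "qprod_inf 1 1 2 * qprod_inf (-1) 1 2 = qprod_inf (-1) 2 4"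
    using qprod_inf_pm[of 2 1] by simp
  also have "\<dots> * eu 2 * eu 4 = eu 2 ^ 2"
    using odd_qprod(2) by (simp add: power2_eq_square mult_ac)
  finally have "(qprod_inf 1 1 2 * eu 1 * eu 4) ^ 2 * eu 2 = (eu 2 ^ 2) ^ 2 * eu 2"
    by (simp only:)
  also have "\<dots> = eu 2 ^ 5"
    by (simp only: power_mult [symmetric] power_Suc2 [symmetric]) simp
  finally have "(qprod_inf 1 1 2 * eu 1 * eu 4) ^ 2 * eu 2 = eu 2 ^ 5" .
  then show ?thesis
    by (simp add: phi power_mult_distrib mult_ac)
qed

lemma phi_minus_product: "phi_minus * eu 2 = eu 1 ^ 2"
proof -
  have "qprod_inf (-1) 1 2 * qprod_inf (-1) 1 2 * eu 2 = iseries UNIV (\<lambda>n. int 1 * n + int 2 * (n * (n - 1) div 2)) (\<lambda>n. (-1) ^ nat \<bar>n\<bar>)"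
    using jacobi_triple_product(1)[of "-1" 1 2] by simp
  also have "\<dots> = phi_minus"
    unfolding phi_minus_def by (rule iseries_cong) (simp add: minus_one_power_abs power2_eq_square algebra_simps)
  finally have "phi_minus * eu 2 = (qprod_inf (-1) 1 2 * eu 2) ^ 2"
    by (simp add: power2_eq_square mult_ac)
  then show ?thesis
    by (simp only: odd_qprod)
qed

text \<open>The triple product with r = 0: its first factor 1 + q^0 is the 2 on the right-hand
  side.\<close>

lemma psi2_product: "psi2 * eu 2 = 2 * eu 4 ^ 2"
proof -
  have "qprod_inf 1 0 2 * qprod_inf 1 2 2 * eu 2 = iseries UNIV (\<lambda>n. int 0 * n + int 2 * (n * (n - 1) div 2)) (\<lambda>n. 1 ^ nat \<bar>n\<bar>)"
    using jacobi_triple_product(1)[of 1 0 2] by simp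
  also have "\<dots> = psi2"
    unfolding psi2_def
    by (rule iseries_reindex[of _ "\<lambda>n. n + 1" _ "\<lambda>n. n - 1"]) (auto simp: power2_eq_square algebra_simps)
  finally have "psi2 = 2 * qprod_inf 1 2 2 ^ 2 * eu 2"
    using qprod_inf_shift[of 2 1 0] by (simp add: power2_eq_square mult_ac flip: numeral_2_eq_2)
  moreover have "qprod_inf 1 2 2 * eu 2 = eu 4"
    using qprod_inf_pm[of 2 2] by (simp add: qprod_inf_eu)
  ultimately have "psi2 * eu 2 = (2 * (qprod_inf 1 2 2)\<^sup>2 * eu 2) * eu 2" "eu 4 = qprod_inf 1 2 2 * eu 2"
    by simp_all
  then show ?thesis
    by (simp only: power2_eq_square mult_ac)
qed

lemma qprod_inf_triple:
  assumes "s > 0"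
  shows "qprod_inf c r s = qprod_inf c r (3 * s) * qprod_inf c (r + s) (3 * s) * qprod_inf c (r + 2 * s) (3 * s)"
proof (rule qprod_inf_eqI[OF assms, of "\<lambda>m. 3 * m"])
  have *: "qprod c r s (3 * m) = qprod c r (3 * s) m * qprod c (r + s) (3 * s) m * qprod c (r + 2 * s) (3 * s) m" for m
  proof (induction m)
    case (Suc m)
    have "3 * Suc m = Suc (Suc (Suc (3 * m)))"
      by simp
    then show ?case
      using Suc.IH by (simp only: qprod_Suc) (simp add: algebra_simps)
  qed simp
  show "filterlim (\<lambda>m::nat. 3 * m) at_top sequentially"
    by (rule mult_nat_left_at_top) simp
  show "(\<lambda>m. qprod c r s (3 * m)) \<longlonglongrightarrow>
      qprod_inf c r (3 * s) * qprod_inf c (r + s) (3 * s) * qprod_inf c (r + 2 * s) (3 * s)"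
    unfolding * using assms by (intro tendsto_mult_fps qprod_tendsto) auto
qed

text \<open>The triple product with modulus 3 r, where the residue classes r, 2 r and 3 r recombine
  to \<open>eu r\<close>. The exponent is r n (3 n - 1) / 2 in the form the triple product
  yields.\<close>

lemma pentagonal:
  assumes "r > 0"
  shows "eu r = iseries UNIV (\<lambda>n. int r * (n + 3 * (n * (n - 1) div 2))) sg"
proof -
  have "qprod_inf (-1) r (3 * r) * qprod_inf (-1) (2 * r) (3 * r) * eu (3 * r) =
      iseries UNIV (\<lambda>n. int r * n + int (3 * r) * (n * (n - 1) div 2)) (\<lambda>n. (-1) ^ nat \<bar>n\<bar>)"
    using jacobi_triple_product(1)[of "-1" r "3 * r"] assms by simp
  also have "\<dots> = iseries UNIV (\<lambda>n. int r * (n + 3 * (n * (n - 1) div 2))) sg"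
    by (rule iseries_cong) (simp add: minus_one_power_abs algebra_simps)
  finally show ?thesis
    using qprod_inf_triple[OF assms, of "-1" r] assms by (simp add: qprod_inf_eu flip: mult_2)
qed

text \<open>On the pentagonal series the substitution only rescales exponents, so composition need
  not be exchanged with an infinite product.\<close>

lemma eu_compose:
  assumes "r > 0" "k > 0"
  shows "eu r oo fps_X ^ k = eu (k * r)"
  using assms by (simp add: pentagonal iseries_compose_X_power mult.assoc)

subsection \<open>Two weighted quadratic series\<close>

lemma admissible_square: "admissible I (\<lambda>n::int. n\<^sup>2)"
proof (rule admissibleI_abs[of _ 0])
  fix n :: int
  show "\<bar>n\<bar> \<le> n\<^sup>2 + 0"
    using abs_le_square_iff[of 1 n] self_le_power[of "\<bar>n\<bar>" 2] by (cases "n = 0") auto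
qed simp

lemma two_mult_half_Suc: "2 * (n * (n + 1) div 2) = n * (n + 1)" for n :: int
  by simp

text \<open>In both applications, the weight is a linear form in \<open>(n, j)\<close>, and a reflection of the quadratic form
  \<open>e\<close> negates it on the class that is dropped.\<close>

lemma iseries_eq_twice_third:
  fixes e c :: "int \<times> int \<Rightarrow> int"
  defines "C \<equiv> \<lambda>k. {p. (snd p - fst p) mod 3 = k}"
  assumes "admissible UNIV e"
    and "\<And>n j. e (- 1 - n, - j) = e (n, j) \<and> c (- 1 - n, - j) = c (n, j)"
    and "iseries (C 2) e c = 0"
  shows "iseries UNIV e c = 2 * iseries (C 0) e c"
proof -
  have "UNIV = C 0 \<union> C 1 \<union> C 2"
    unfolding C_def by auto
  then have "iseries UNIV e c = iseries (C 0 \<union> C 1 \<union> C 2) e c"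
    by simp
  also have "\<dots> = iseries (C 0 \<union> C 1) e c + iseries (C 2) e c"
    by (intro iseries_Un admissible_subset[OF assms(2)]) (auto simp: C_def)
  also have "iseries (C 0 \<union> C 1) e c = iseries (C 0) e c + iseries (C 1) e c"
    by (intro iseries_Un admissible_subset[OF assms(2)]) (auto simp: C_def)
  also have "iseries (C 1) e c = iseries (C 0) e c"
    by (rule iseries_reindex[of _ "\<lambda>(n, j). (- 1 - n, - j)" _ "\<lambda>(n, j). (- 1 - n, - j)"])
      (auto simp: C_def assms(3), presburger+)
  finally show ?thesis
    using assms(4) by simp
qed

definition H_series :: "int fps" where
  "H_series = iseries UNIV (\<lambda>n. n * (3 * n + 1) div 2) (\<lambda>n. 6 * n + 1)"

definition K_series :: "int fps" where
  "K_series = iseries UNIV (\<lambda>n. 3 * n\<^sup>2 + 2 * n) (\<lambda>n. sg n * (3 * n + 1))"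

lemma admissible_H: "admissible I (\<lambda>n::int. n * (3 * n + 1) div 2)"
proof (rule admissibleI_abs[of _ 0])
  fix n :: int
  have "2 * (n * (3 * n + 1) div 2) = n * (3 * n + 1)"
    by simp
  moreover have "2 * \<bar>n\<bar> \<le> n * (3 * n + 1)"
  proof -
    have "\<bar>n\<bar> \<le> n * n"
      using self_le_power[of "\<bar>n\<bar>" 2] by (cases "n = 0") (auto simp: power2_eq_square)
    then show ?thesis
      by (simp add: algebra_simps abs_if split: if_splits)
  qed
  ultimately show "\<bar>n\<bar> \<le> n * (3 * n + 1) div 2 + 0" "0 \<le> n * (3 * n + 1) div 2"
    by linarith+
qed

lemma admissible_K: "admissible I (\<lambda>n::int. 3 * n\<^sup>2 + 2 * n)"
proof (rule admissibleI_abs[of _ 0])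
  fix n :: int
  have "\<bar>n\<bar> \<le> 3 * n\<^sup>2 + 2 * n"
    using self_le_power[of "\<bar>n\<bar>" 2] by (cases "n = 0") (auto simp: abs_if split: if_splits)
  then show "\<bar>n\<bar> \<le> 3 * n\<^sup>2 + 2 * n + 0" "0 \<le> 3 * n\<^sup>2 + 2 * n"
    by linarith+
qed

lemma admissible_pentagonal:
  assumes "r > 0"
  shows "admissible I (\<lambda>n. int r * (n + 3 * (n * (n - 1) div 2)))"
  using jacobi_triple_product(2)[of 1 r "3 * r" I] assms by (simp add: algebra_simps)

text \<open>With \<open>phi_minus_product\<close> this says \<open>H_series\<close> = E_1^5 / E_2^2.
  The right-hand side is half a double series over the form (2 n + 1)^2 + 8 j^2 = 8 e + 1, which is
  evaluated by classes of j - n modulo 3.\<close>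

lemma H_series_product: "H_series * eu 2 = eu 1 ^ 3 * phi_minus"
proof -
  define e :: "int \<times> int \<Rightarrow> int" where "e = (\<lambda>(n, j). 1 * (n * (n + 1) div 2) + j\<^sup>2)"
  define c :: "int \<times> int \<Rightarrow> int" where "c = (\<lambda>(n, j). sg n * sg j * (2 * n + 1 + 4 * j))"
  define C where "C = (\<lambda>k::int. {p::int\<times>int. (snd p - fst p) mod 3 = k})"
  have adm: "admissible UNIV e"
    using admissible_Times[OF admissible_triangular[of 1 UNIV] admissible_square[of UNIV]] by (simp add: e_def)
  have e2: "2 * e (n, j) = n * (n + 1) + 2 * j\<^sup>2" for n j
    using two_mult_half_Suc[of n] by (simp add: e_def)
  have e_eqI: "e (n, j) = x" if "n * (n + 1) + 2 * j\<^sup>2 = 2 * x" for n j x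
    using e2[of n j] that by simp
  \<comment> \<open>This part is odd in j. Adding it changes the weight to 2 n + 1 + 4 j, the linear
    form that the reflection below negates.\<close>
  have "iseries UNIV e (\<lambda>(n, j). sg n * sg j * (4 * j)) = 0"
    by (rule iseries_eq_0_involution[of _ "\<lambda>(n, j). (n, - j)"]) (auto simp: e_def)
  then have "2 * eu 1 ^ 3 * phi_minus = iseries UNIV e (\<lambda>(n, j). sg n * (2 * n + 1) * sg j) + iseries UNIV e (\<lambda>(n, j). sg n * sg j * (4 * j))"
    using jacobi_cube[of 1] iseries_mult[OF admissible_triangular[of 1 UNIV] admissible_square[of UNIV], of "\<lambda>n. sg n * (2 * n + 1)" sg]
    by (simp add: phi_minus_def e_def)
  also have "\<dots> = iseries UNIV e c"
    unfolding iseries_add by (rule iseries_cong) (auto simp: c_def algebra_simps)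
  also have "\<dots> = 2 * iseries (C 0) e c"
    unfolding C_def
  proof (rule iseries_eq_twice_third[OF adm])
    show "e (- 1 - n, - j) = e (n, j) \<and> c (- 1 - n, - j) = c (n, j)" for n j
    proof
      show "e (- 1 - n, - j) = e (n, j)"
        by (rule e_eqI) (simp add: e2 algebra_simps)
      show "c (- 1 - n, - j) = c (n, j)"
        by (simp add: c_def sg_def algebra_simps)
    qed
    show "iseries {p. (snd p - fst p) mod 3 = 2} e c = 0"
    \<comment> \<open>The reflection of (2 n + 1)^2 + 8 j^2 along the vector (2, 1) in the
      coordinates (2 n + 1, j). It is integral exactly when 3 divides 2 n + 1 + 4 j, that is, on the
      class j - n = 2 modulo 3.\<close>
    proof (rule iseries_eq_0_involution[of _ "\<lambda>(n, j). (n - (2 * n + 1 + 4 * j) div 3, j - (2 * n + 1 + 4 * j) div 3)"], goal_cases)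
      case (1 p)
      obtain n j where p: "p = (n, j)" by fastforce
      with 1 have 1: "(j - n) mod 3 = 2"
        by simp
      define t where "t = (2 * n + 1 + 4 * j) div 3"
      have t: "3 * t = 2 * n + 1 + 4 * j"
        using 1 unfolding t_def by presburger
      have "2 * (n - t) + 1 + 4 * (j - t) = 3 * (- t)"
        using t by simp
      then have t': "(2 * (n - t) + 1 + 4 * (j - t)) div 3 = - t"
        by simp
      have "e (n - t, j - t) = e (n, j)"
      proof (rule e_eqI)
        have "(n - t) * (n - t + 1) + 2 * (j - t)\<^sup>2 = n * (n + 1) + 2 * j\<^sup>2"
          using t by algebra
        then show "(n - t) * (n - t + 1) + 2 * (j - t)\<^sup>2 = 2 * e (n, j)"
          by (simp add: e2)
      qed
      moreover have "c (n - t, j - t) = - c (n, j)"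
      proof -
        have "sg (n - t) * sg (j - t) = sg n * sg j"
          by (auto simp: sg_def)
        moreover have "2 * (n - t) + 1 + 4 * (j - t) = - (2 * n + 1 + 4 * j)"
          using t by simp
        ultimately show ?thesis
          unfolding c_def by (simp only: prod.case mult_minus_right)
      qed
      ultimately show ?case
        unfolding p prod.case t_def [symmetric] t' using 1 by simp
    qed
  qed
  also have "iseries (C 0) e c = H_series * eu 2"
  proof -
    have "iseries (C 0) e c = iseries (UNIV \<times> UNIV)
       (\<lambda>(m, k). m * (3 * m + 1) div 2 + int 2 * (k + 3 * (k * (k - 1) div 2))) (\<lambda>(m, k). (6 * m + 1) * sg k)"
    \<comment> \<open>In the coordinates (m, k) the form has no mixed term, and the weight 2 n + 1 +
      4 j becomes 6 m + 1.\<close>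
    proof (rule iseries_reindex[of _ "\<lambda>(m, k). (m - 2 * k, m + k)" _ "\<lambda>(n, j). (j - (j - n) div 3, (j - n) div 3)"], goal_cases)
      case (1 p)
      obtain m k where p: "p = (m, k)" by fastforce
      define u v where "u = k * (k - 1) div 2" and "v = m * (3 * m + 1) div 2"
      have "2 * u = k * (k - 1)" "2 * v = m * (3 * m + 1)"
        by (simp_all add: u_def v_def)
      then have "e (m - 2 * k, m + k) = m * (3 * m + 1) div 2 + int 2 * (k + 3 * (k * (k - 1) div 2))"
        unfolding u_def [symmetric] v_def [symmetric]
        by (intro e_eqI) (simp add: algebra_simps power2_eq_square)
      then show ?case
        unfolding p by (auto simp: C_def c_def sg_def)
    next
      case (2 p)
      obtain n j where p: "p = (n, j)" by fastforce
      with 2 have "(j - n) mod 3 = 0"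
        by (simp add: C_def)
      then have "3 * ((j - n) div 3) = j - n"
        by presburger
      then show ?case
        unfolding p by simp
    qed
    then show ?thesis
      unfolding H_series_def pentagonal[of 2, simplified] iseries_mult[OF admissible_H admissible_pentagonal[of 2, simplified]] by simp
  qed
  finally show ?thesis
    by simp
qed

text \<open>The argument for \<open>H_series_product\<close> with the form (2 n + 1)^2 + 2 j^2 = 2 e
  + 1. The odd part added to the weight is j, and n = m - k, j = m + 2 k turns 2 n + 1 + j into 3 m
  + 1.\<close>

lemma K_series_product: "K_series * eu 4 = eu 4 ^ 3 * phi"
proof -
  define e :: "int \<times> int \<Rightarrow> int" where "e = (\<lambda>(n, j). 4 * (n * (n + 1) div 2) + j\<^sup>2)"
  define c :: "int \<times> int \<Rightarrow> int" where "c = (\<lambda>(n, j). sg n * (2 * n + 1 + j))"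
  define C where "C = (\<lambda>k::int. {p::int\<times>int. (snd p - fst p) mod 3 = k})"
  have adm: "admissible UNIV e"
    using admissible_Times[OF admissible_triangular[of 4 UNIV] admissible_square[of UNIV]] by (simp add: e_def)
  have e2: "e (n, j) = 2 * (n * (n + 1)) + j\<^sup>2" for n j
    using two_mult_half_Suc[of n] by (simp add: e_def)
  have "iseries UNIV e (\<lambda>(n, j). sg n * j) = 0"
    by (rule iseries_eq_0_involution[of _ "\<lambda>(n, j). (n, - j)"]) (auto simp: e_def)
  then have "2 * eu 4 ^ 3 * phi = iseries UNIV e (\<lambda>(n, j). sg n * (2 * n + 1) * 1) + iseries UNIV e (\<lambda>(n, j). sg n * j)"
    using jacobi_cube[of 4] iseries_mult[OF admissible_triangular[of 4 UNIV] admissible_square[of UNIV], of "\<lambda>n. sg n * (2 * n + 1)" "\<lambda>_. 1"]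
    by (simp add: phi_def e_def)
  also have "\<dots> = iseries UNIV e c"
    unfolding iseries_add by (rule iseries_cong) (auto simp: c_def algebra_simps)
  also have "\<dots> = 2 * iseries (C 0) e c"
    unfolding C_def
  proof (rule iseries_eq_twice_third[OF adm])
    show "e (- 1 - n, - j) = e (n, j) \<and> c (- 1 - n, - j) = c (n, j)" for n j
      by (simp add: e2 c_def sg_def algebra_simps)
    show "iseries {p. (snd p - fst p) mod 3 = 2} e c = 0"
    \<comment> \<open>Again the reflection along (2, 1) in the coordinates (2 n + 1, j), now for the
      form (2 n + 1)^2 + 2 j^2.\<close>
    proof (rule iseries_eq_0_involution[of _ "\<lambda>(n, j). (n - 2 * ((2 * n + 1 + j) div 3), j - 2 * ((2 * n + 1 + j) div 3))"], goal_cases)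
      case (1 p)
      obtain n j where p: "p = (n, j)" by fastforce
      with 1 have 1: "(j - n) mod 3 = 2"
        by simp
      define t where "t = (2 * n + 1 + j) div 3"
      have t: "3 * t = 2 * n + 1 + j"
        using 1 unfolding t_def by presburger
      have "2 * (n - 2 * t) + 1 + (j - 2 * t) = 3 * (- t)"
        using t by simp
      then have t': "(2 * (n - 2 * t) + 1 + (j - 2 * t)) div 3 = - t"
        by simp
      have "e (n - 2 * t, j - 2 * t) = e (n, j)"
        unfolding e2 using t by algebra
      moreover have "c (n - 2 * t, j - 2 * t) = - c (n, j)"
      proof -
        have "sg (n - 2 * t) = sg n"
          by (auto simp: sg_def)
        moreover have "2 * (n - 2 * t) + 1 + (j - 2 * t) = - (2 * n + 1 + j)"
          using t by simp
        ultimately show ?thesis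
          unfolding c_def by (simp only: prod.case mult_minus_right)
      qed
      ultimately show ?case
        unfolding p prod.case t_def [symmetric] t' using 1 by simp
    qed
  qed
  also have "iseries (C 0) e c = K_series * eu 4"
  proof -
    have "iseries (C 0) e c = iseries (UNIV \<times> UNIV)
       (\<lambda>(m, k). (3 * m\<^sup>2 + 2 * m) + int 4 * (k + 3 * (k * (k - 1) div 2))) (\<lambda>(m, k). sg m * (3 * m + 1) * sg k)"
    proof (rule iseries_reindex[of _ "\<lambda>(m, k). (m - k, m + 2 * k)" _ "\<lambda>(n, j). (n + (j - n) div 3, (j - n) div 3)"], goal_cases)
      case (1 p)
      obtain m k where p: "p = (m, k)" by fastforce
      define u where "u = k * (k - 1) div 2"
      have "2 * u = k * (k - 1)"
        by (simp add: u_def)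
      then have "e (m - k, m + 2 * k) = (3 * m\<^sup>2 + 2 * m) + int 4 * (k + 3 * (k * (k - 1) div 2))"
        unfolding e2 u_def [symmetric] by (simp add: algebra_simps power2_eq_square)
      then show ?case
        unfolding p by (auto simp: C_def c_def sg_def)
    next
      case (2 p)
      obtain n j where p: "p = (n, j)" by fastforce
      with 2 have "(j - n) mod 3 = 0"
        by (simp add: C_def)
      then have "3 * ((j - n) div 3) = j - n"
        by presburger
      then show ?case
        unfolding p by simp
    qed
    then show ?thesis
      unfolding K_series_def pentagonal[of 4, simplified] iseries_mult[OF admissible_K admissible_pentagonal[of 4, simplified]] by simp
  qed
  finally show ?thesis
    by simp
qed

subsection \<open>The sixth power of the Euler product\<close>

definition tri :: "int \<Rightarrow> int" where
  "tri n = n * (n + 1) div 2"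

lemma two_mult_tri: "2 * tri n = n * (n + 1)"
  by (simp add: tri_def)

lemma admissible_tri: "k > 0 \<Longrightarrow> admissible I (\<lambda>n. k * tri n)"
  unfolding tri_def by (rule admissible_triangular)

lemma jacobi_cube_tri: "r > 0 \<Longrightarrow> 2 * eu r ^ 3 = iseries UNIV (\<lambda>n. int r * tri n) (\<lambda>n. sg n * (2 * n + 1))"
  unfolding tri_def by (rule jacobi_cube)

lemma eu_sixth_series:
  "4 * eu 1 ^ 6 = iseries UNIV (\<lambda>(a, b). tri a + tri b) (\<lambda>(a, b). (sg a * (2 * a + 1)) * (sg b * (2 * b + 1)))"
proof -
  have "4 * eu 1 ^ 6 = (2 * eu 1 ^ 3) * (2 * eu 1 ^ 3)"
    by (simp flip: power_add)
  also have "\<dots> = iseries UNIV (\<lambda>(a, b). 1 * tri a + 1 * tri b) (\<lambda>(a, b). (sg a * (2 * a + 1)) * (sg b * (2 * b + 1)))"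
    using jacobi_cube_tri[of 1] iseries_mult[OF admissible_tri[of 1 UNIV] admissible_tri[of 1 UNIV]] by simp
  finally show ?thesis
    by simp
qed

lemma admissible_tri_tri: "admissible I (\<lambda>(a, b). tri a + tri b)"
  using admissible_subset[OF admissible_Times[OF admissible_tri[of 1 UNIV] admissible_tri[of 1 UNIV]], of I] by simp

lemma admissible_psi2: "admissible I (\<lambda>n::int. n\<^sup>2 + n)"
proof -
  have "2 * tri n = n\<^sup>2 + n" for n
    unfolding two_mult_tri by (simp add: power2_eq_square algebra_simps)
  then show ?thesis
    using admissible_tri[of 2 I] by simp
qed

text \<open>Setting a = r + s, b = r - s in the square of Jacobi's series separates the exponent
  into r^2 + r and s^2 and turns (2 a + 1) (2 b + 1) into (2 r + 1)^2 - 4 s^2. Up to powers of q and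
  a factor 4, the right-hand side is the Wronskian of q^(1/4) \<open>psi2\<close> and
  \<open>phi\<close>.\<close>

lemma eu_sixth_theta:
  "2 * eu 1 ^ 6 = (4 * (fps_X * fps_deriv psi2) + psi2) * phi - 4 * (psi2 * (fps_X * fps_deriv phi))"
proof -
  define V where "V = iseries UNIV (\<lambda>(r::int, s::int). (r\<^sup>2 + r) + s\<^sup>2) (\<lambda>(r, s). (2 * r + 1)\<^sup>2 - 4 * s\<^sup>2)"
  define e where "e = (\<lambda>(a, b). tri a + tri b)"
  define c where "c = (\<lambda>(a, b). (sg a * (2 * a + 1)) * (sg b * (2 * b + 1)))"
  define I0 I1 where "I0 = {(a::int, b::int). even (a + b)}" and "I1 = {(a::int, b::int). odd (a + b)}"
  have "4 * eu 1 ^ 6 = iseries (I0 \<union> I1) e c"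
  proof -
    have "I0 \<union> I1 = UNIV"
      by (auto simp: I0_def I1_def)
    then show ?thesis
      unfolding eu_sixth_series e_def c_def by simp
  qed
  also have "\<dots> = iseries I0 e c + iseries I1 e c"
    unfolding e_def by (rule iseries_Un[OF admissible_tri_tri]) (auto simp: I0_def I1_def)
  \<comment> \<open>The map a to -1 - a changes the parity of a + b and leaves every term unchanged,
    so only the even half needs the rotation.\<close>
  also have "iseries I1 e c = iseries I0 e c"
  proof (rule iseries_reindex[of _ "\<lambda>(x, y). (- 1 - x, y)" _ "\<lambda>(x, y). (- 1 - x, y)"])
    have "tri (- 1 - a) = tri a" for a
      by (simp add: tri_def algebra_simps)
    moreover have "sg (- 1 - a) = - sg a" for a
      by (simp add: sg_def)
    ultimately have "e (- 1 - x, y) = e (x, y) \<and> c (- 1 - x, y) = c (x, y)" for x y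
      by (simp add: e_def c_def algebra_simps)
    then show "p \<in> I0 \<Longrightarrow> (\<lambda>(x, y). (- 1 - x, y)) p \<in> I1 \<and> (\<lambda>(x, y). (- 1 - x, y)) ((\<lambda>(x, y). (- 1 - x, y)) p) = p
        \<and> e ((\<lambda>(x, y). (- 1 - x, y)) p) = e p \<and> c ((\<lambda>(x, y). (- 1 - x, y)) p) = c p" for p
      by (cases p) (auto simp: I0_def I1_def)
  qed (auto simp: I0_def I1_def)
  also have "iseries I0 e c = V"
    unfolding V_def
  proof (rule iseries_reindex[of _ "\<lambda>(r, s). (r + s, r - s)" _ "\<lambda>(a, b). ((a + b) div 2, (a - b) div 2)"], goal_cases)
    case (1 p)
    obtain r s where p: "p = (r, s)" by fastforce
    have "2 * (tri (r + s) + tri (r - s)) = 2 * (r\<^sup>2 + r + s\<^sup>2)"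
      unfolding distrib_left[of 2 "tri (r + s)"] two_mult_tri by (simp add: power2_eq_square algebra_simps)
    then have "tri (r + s) + tri (r - s) = r\<^sup>2 + r + s\<^sup>2"
      by simp
    moreover have "sg (r + s) * sg (r - s) = 1"
      by (auto simp: sg_def)
    then have "c (r + s, r - s) = 1 * ((2 * (r + s) + 1) * (2 * (r - s) + 1))"
      unfolding c_def prod.case by (metis mult.assoc mult.left_commute)
    then have "c (r + s, r - s) = (2 * r + 1)\<^sup>2 - 4 * s\<^sup>2"
      by (simp add: power2_eq_square algebra_simps)
    ultimately show ?case
      unfolding p by (simp add: I0_def e_def)
  next
    case (2 p)
    obtain a b where p: "p = (a, b)" by fastforce
    with 2 have "even (a + b)" "even (a - b)"
      by (auto simp: I0_def)
    then obtain u v where "a + b = 2 * u" "a - b = 2 * v"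
      by (metis evenE)
    moreover from this have "a = u + v" "b = u - v"
      by simp_all
    ultimately show ?case
      unfolding p by simp
  qed
  finally have "4 * eu 1 ^ 6 = 2 * V"
    by simp
  then have "2 * eu 1 ^ 6 = V"
    by simp
  moreover have "(4 * (fps_X * fps_deriv psi2) + psi2) * phi - 4 * (psi2 * (fps_X * fps_deriv phi)) = V"
  proof -
    have 4: "4 * f = fps_const 4 * f" for f :: "int fps"
      by (simp add: numeral_fps_const)
    have "4 * (fps_X * fps_deriv psi2) + psi2 = iseries UNIV (\<lambda>n. n\<^sup>2 + n) (\<lambda>n. (2 * n + 1)\<^sup>2)"
      unfolding psi2_def iseries_theta 4 iseries_const_mult iseries_add
      by (rule iseries_cong) (simp add: power2_eq_square algebra_simps)
    then have 1: "(4 * (fps_X * fps_deriv psi2) + psi2) * phi =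
        iseries (UNIV \<times> UNIV) (\<lambda>(r, s). r\<^sup>2 + r + s\<^sup>2) (\<lambda>(r, s). (2 * r + 1)\<^sup>2 * 1)"
      unfolding phi_def by (simp only: iseries_mult[OF admissible_psi2 admissible_square])
    have "4 * (psi2 * (fps_X * fps_deriv phi)) =
        iseries (UNIV \<times> UNIV) (\<lambda>(r, s). r\<^sup>2 + r + s\<^sup>2) (\<lambda>p. 4 * (case p of (r, s) \<Rightarrow> 1 * (s\<^sup>2 * 1)))"
      unfolding phi_def psi2_def iseries_theta 4 iseries_mult[OF admissible_psi2 admissible_square] iseries_const_mult ..
    then show ?thesis
      unfolding 1 V_def by (simp only: iseries_diff UNIV_Times_UNIV) (rule iseries_cong, auto)
  qed
  ultimately show ?thesis
    by simp
qed

subsection \<open>A two-variable series for the fifth powers\<close>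

text \<open>The cube keeps the exponents of Jacobi's series and only changes signs; it supplies the
  first function of the Wronskian in \<open>eu_fifth_series\<close>.\<close>

definition eu_minus :: "int fps" where
  "eu_minus = eu 1 oo - fps_X"

lemma eu_minus_cube: "2 * eu_minus ^ 3 = iseries UNIV tri (\<lambda>n. sg (tri n) * (sg n * (2 * n + 1)))"
proof -
  have "2 * eu_minus ^ 3 = (2 * eu 1 ^ 3) oo - fps_X"
    by (simp add: eu_minus_def fps_compose_power fps_compose_mult_distrib numeral_fps_const)
  also have "\<dots> = iseries UNIV tri (\<lambda>n. sg (tri n) * (sg n * (2 * n + 1)))"
    using jacobi_cube_tri[of 1] by (simp add: iseries_compose_uminus_X)
  finally show ?thesis .
qed

text \<open>Replacing q by -q in \<open>phi_minus_product\<close> gives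
  \<open>phi * eu 2 = eu_minus ^ 2\<close>, hence the square of the claim; the constant terms decide
  the sign.\<close>

lemma eu_minus_product: "eu_minus * eu 1 * eu 4 = eu 2 ^ 3"
proof -
  have "phi_minus oo - fps_X = phi"
    unfolding phi_minus_def phi_def iseries_compose_uminus_X by (rule iseries_cong) (simp add: sg_def)
  moreover have "eu 2 oo - fps_X = eu 2"
    unfolding pentagonal[of 2, simplified] iseries_compose_uminus_X by (rule iseries_cong) (simp add: sg_def)
  ultimately have "phi * eu 2 = eu_minus ^ 2"
    using arg_cong[OF phi_minus_product, of "\<lambda>f. f oo - fps_X"]
    by (simp add: eu_minus_def fps_compose_power fps_compose_mult_distrib)
  then have "(eu_minus * eu 1 * eu 4)\<^sup>2 = eu 2 * (phi * eu 1 ^ 2 * eu 4 ^ 2)"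
    by (simp add: power_mult_distrib mult_ac)
  also have "\<dots> = (eu 2 ^ 3)\<^sup>2"
    unfolding phi_product by (simp flip: power_Suc)
  finally have "eu_minus * eu 1 * eu 4 = eu 2 ^ 3 \<or> eu_minus * eu 1 * eu 4 = - (eu 2 ^ 3)"
    by (simp only: power2_eq_iff)
  moreover have "fps_nth (eu_minus * eu 1 * eu 4) 0 = 1" "fps_nth (- (eu 2 ^ 3)) 0 = - 1"
    by (simp_all add: eu_minus_def fps_compose_nth fps_nth_power_0)
  ultimately show ?thesis
    by (metis one_neq_neg_one)
qed

text \<open>The constant: \<open>W * (psi2 * phi)\<close> is -6 A B E_1^6, the cubes in A and B
  carry a 2 each, and \<open>psi2\<close> carries a 2 on the other side, so -6 * 4 / 2 =
  -12.\<close>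

lemma eu_fifth_series:
  "-12 * (eu 1 ^ 5 * eu 2 ^ 5) = iseries UNIV (\<lambda>(j, k). tri j + 4 * tri k)
     (\<lambda>(j, k). (sg (tri j) * (sg j * (2 * j + 1))) * (sg k * (2 * k + 1)) * ((2 * j + 1)\<^sup>2 - 4 * (2 * k + 1)\<^sup>2))"
proof -
  define \<theta> where "\<theta> = (\<lambda>f::int fps. fps_X * fps_deriv f)"
  have \<theta>_mult: "\<theta> (f * g) = \<theta> f * g + f * \<theta> g" for f g
    by (simp add: \<theta>_def algebra_simps)
  have \<theta>_square: "\<theta> (f\<^sup>2) = 2 * f * \<theta> f" for f
    by (simp add: power2_eq_square \<theta>_mult algebra_simps)
  have \<theta>_cube: "\<theta> (f ^ 3) = 3 * f\<^sup>2 * \<theta> f" for f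
    by (simp add: power3_eq_cube power2_eq_square \<theta>_mult algebra_simps)
  define A where "A = 2 * eu_minus ^ 3"
  define B where "B = 2 * eu 4 ^ 3"
  \<comment> \<open>The Wronskian of q^(1/8) A and q^(1/2) B, times 8 and up to a power of q. The
    shifts 1/8 and 1/2 complete the squares: 8 \<open>tri j\<close> + 1 = (2 j + 1)^2 and 32
    \<open>tri k\<close> + 4 = 4 (2 k + 1)^2.\<close>
  define W where "W = (8 * \<theta> A + A) * B - A * (8 * \<theta> B + 4 * B)"
  note P = psi2_product and Q = phi_product and F = eu_minus_product
  have F0: "eu_minus \<noteq> 0"
    using F by auto
  have nz: "A \<noteq> 0" "B \<noteq> 0" "psi2 \<noteq> 0" "phi \<noteq> 0"
    using F0 P Q by (auto simp: A_def B_def)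

  have "A\<^sup>2 * psi2 ^ 3 * (eu 1 ^ 6 * eu 2 ^ 3) = 4 * eu_minus ^ 6 * eu 1 ^ 6 * (psi2 * eu 2) ^ 3"
    by (simp add: A_def power_mult_distrib mult_ac flip: power_mult)
  also have "\<dots> = 32 * (eu_minus * eu 1 * eu 4) ^ 6"
    unfolding P by (simp add: power_mult_distrib mult_ac flip: power_mult)
  also have "\<dots> = 32 * eu 2 ^ 15 * eu 2 ^ 3"
    unfolding F by (simp flip: power_mult power_add)
  also have "eu 2 ^ 15 = (phi * eu 1 ^ 2 * eu 4 ^ 2) ^ 3"
    unfolding Q by (simp flip: power_mult)
  also have "32 * (phi * eu 1 ^ 2 * eu 4 ^ 2) ^ 3 * eu 2 ^ 3 = 8 * B\<^sup>2 * phi ^ 3 * (eu 1 ^ 6 * eu 2 ^ 3)"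
    by (simp add: B_def power_mult_distrib mult_ac flip: power_mult)
  finally have AP: "A\<^sup>2 * psi2 ^ 3 = 8 * (B\<^sup>2 * phi ^ 3)"
    by simp

  text \<open>Up to powers of \<open>q\<close>, both \<open>W\<close> and the right-hand side of \<open>eu_sixth_theta\<close> are Wronskians: of \<open>A, B\<close> and of
    \<open>psi2, phi\<close>. The logarithmic derivative of \<open>AP\<close> makes them proportional.\<close>
  have "\<theta> (A\<^sup>2 * psi2 ^ 3) = 8 * \<theta> (B\<^sup>2 * phi ^ 3)"
    unfolding AP by (simp add: \<theta>_def mult_ac)
  then have "(A * psi2\<^sup>2 * (2 * \<theta> A * psi2 + 3 * A * \<theta> psi2)) * (B * phi) = 8 * (B * phi\<^sup>2 * (2 * \<theta> B * phi + 3 * B * \<theta> phi)) * (B * phi)"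
    unfolding \<theta>_mult \<theta>_square \<theta>_cube by (simp add: power2_eq_square power3_eq_cube algebra_simps)
  also have "\<dots> = 8 * (B\<^sup>2 * phi ^ 3) * (2 * \<theta> B * phi + 3 * B * \<theta> phi)"
    by (simp add: power2_eq_square power3_eq_cube mult_ac)
  also have "\<dots> = A * psi2\<^sup>2 * (A * psi2 * (2 * \<theta> B * phi + 3 * B * \<theta> phi))"
    unfolding AP [symmetric] by (simp add: power2_eq_square power3_eq_cube mult_ac)
  finally have "A * psi2\<^sup>2 * ((2 * \<theta> A * psi2 + 3 * A * \<theta> psi2) * (B * phi)) = A * psi2\<^sup>2 * (A * psi2 * (2 * \<theta> B * phi + 3 * B * \<theta> phi))"
    by (simp only: mult_ac)
  then have wr: "(2 * \<theta> A * psi2 + 3 * A * \<theta> psi2) * (B * phi) = A * psi2 * (2 * \<theta> B * phi + 3 * B * \<theta> phi)"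
    using nz by simp
  have V: "(4 * \<theta> psi2 + psi2) * phi - 4 * (psi2 * \<theta> phi) = 2 * eu 1 ^ 6"
    unfolding \<theta>_def by (rule eu_sixth_theta [symmetric])
  have "W * (psi2 * phi) = 4 * ((2 * \<theta> A * psi2 + 3 * A * \<theta> psi2) * (B * phi)) - 4 * (A * psi2 * (2 * \<theta> B * phi + 3 * B * \<theta> phi))
      - 3 * A * B * ((4 * \<theta> psi2 + psi2) * phi - 4 * (psi2 * \<theta> phi))"
    by (simp add: W_def algebra_simps)
  also have "\<dots> = - 6 * A * B * eu 1 ^ 6"
    unfolding wr V by simp
  finally have WPQ: "W * (psi2 * phi) = - 6 * A * B * eu 1 ^ 6" .
  have "W * (2 * eu 4 ^ 2 * eu 2 ^ 5) = W * ((psi2 * eu 2) * (phi * eu 1 ^ 2 * eu 4 ^ 2))"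
    unfolding P Q ..
  also have "\<dots> = (W * (psi2 * phi)) * (eu 2 * eu 1 ^ 2 * eu 4 ^ 2)"
    by (simp only: mult_ac)
  also have "\<dots> = - 24 * (eu_minus * eu 1 * eu 4) ^ 3 * eu 1 ^ 5 * eu 2 * eu 4 ^ 2"
    unfolding WPQ A_def B_def by (simp add: power_mult_distrib mult_ac flip: power_add)
  also have "\<dots> = (-12 * (eu 1 ^ 5 * eu 2 ^ 5)) * (2 * eu 4 ^ 2 * eu 2 ^ 5)"
  proof -
    have "(x ^ 3) ^ 3 * y * x * z = y * x ^ 5 * (z * x ^ 5)" for x y z :: "int fps"
      by (simp add: mult_ac eval_nat_numeral)
    then have "(eu 2 ^ 3) ^ 3 * eu 1 ^ 5 * eu 2 * eu 4 ^ 2 = eu 1 ^ 5 * eu 2 ^ 5 * (eu 4 ^ 2 * eu 2 ^ 5)"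
      .
    then show ?thesis
      unfolding F by (simp add: mult.assoc)
  qed
  finally have "W * (2 * eu 4 ^ 2 * eu 2 ^ 5) = (-12 * (eu 1 ^ 5 * eu 2 ^ 5)) * (2 * eu 4 ^ 2 * eu 2 ^ 5)" .
  moreover have "2 * eu 4 ^ 2 * eu 2 ^ 5 \<noteq> 0"
    by simp
  ultimately have WZ: "W = -12 * (eu 1 ^ 5 * eu 2 ^ 5)"
    using mult_right_cancel by blast

  have A: "A = iseries UNIV tri (\<lambda>n. sg (tri n) * (sg n * (2 * n + 1)))"
    unfolding A_def by (rule eu_minus_cube)
  have B: "B = iseries UNIV (\<lambda>n. 4 * tri n) (\<lambda>n. sg n * (2 * n + 1))"
    unfolding B_def using jacobi_cube_tri[of 4] by simp
  have num: "4 * f = fps_const 4 * f" "8 * f = fps_const 8 * f" for f :: "int fps"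
    by (simp_all add: numeral_fps_const)
  have "8 * \<theta> A + A = iseries UNIV tri (\<lambda>n. (2 * n + 1)\<^sup>2 * (sg (tri n) * (sg n * (2 * n + 1))))"
    unfolding A \<theta>_def iseries_theta num iseries_const_mult iseries_add
  proof (rule iseries_cong, rule conjI[OF refl])
    fix n
    have "8 * tri n + 1 = (2 * n + 1)\<^sup>2"
      using two_mult_tri[of n] by (simp add: power2_eq_square algebra_simps)
    then show "8 * (tri n * (sg (tri n) * (sg n * (2 * n + 1)))) + sg (tri n) * (sg n * (2 * n + 1)) = (2 * n + 1)\<^sup>2 * (sg (tri n) * (sg n * (2 * n + 1)))"
      by (metis distrib_right mult.assoc mult_1)
  qed
  moreover have "8 * \<theta> B + 4 * B = iseries UNIV (\<lambda>n. 4 * tri n) (\<lambda>n. 4 * (2 * n + 1)\<^sup>2 * (sg n * (2 * n + 1)))"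
    unfolding B \<theta>_def iseries_theta num iseries_const_mult iseries_add
  proof (rule iseries_cong, rule conjI[OF refl])
    fix n
    have "8 * (4 * tri n) + 4 = 4 * (2 * n + 1)\<^sup>2"
      using two_mult_tri[of n] by (simp add: power2_eq_square algebra_simps)
    then show "8 * (4 * tri n * (sg n * (2 * n + 1))) + 4 * (sg n * (2 * n + 1)) = 4 * (2 * n + 1)\<^sup>2 * (sg n * (2 * n + 1))"
      by (metis distrib_right mult.assoc)
  qed
  ultimately have "W = iseries UNIV (\<lambda>(j, k). tri j + 4 * tri k)
     (\<lambda>(j, k). (sg (tri j) * (sg j * (2 * j + 1))) * (sg k * (2 * k + 1)) * ((2 * j + 1)\<^sup>2 - 4 * (2 * k + 1)\<^sup>2))"
    unfolding W_def
    unfolding A B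
    using iseries_mult[OF admissible_tri[of 1 UNIV] admissible_tri[of 4 UNIV]]
    by (simp add: iseries_diff) (rule iseries_cong, auto simp: algebra_simps)
  with WZ show ?thesis
    by simp
qed

subsection \<open>Congruences\<close>

lemma numeral_dvd_fps_iff: "(numeral k :: int fps) dvd f \<longleftrightarrow> (\<forall>n. numeral k dvd fps_nth f n)"
proof
  assume "numeral k dvd f"
  then show "\<forall>n. numeral k dvd fps_nth f n"
    by (auto simp: numeral_fps_const elim!: dvdE)
next
  assume *: "\<forall>n. numeral k dvd fps_nth f n"
  have "f = numeral k * Abs_fps (\<lambda>n. fps_nth f n div numeral k)"
    by (rule fps_ext) (use * in \<open>simp add: numeral_fps_const\<close>)
  then show "numeral k dvd f"
    by (rule dvdI)
qed

lemma dvd_diff_mult: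
  fixes x y :: "'a::comm_ring_1"
  assumes "d dvd x - x'" "d dvd y - y'"
  shows "d dvd x * y - x' * y'"
proof -
  have "x * y - x' * y' = (x - x') * y + x' * (y - y')"
    by (simp add: algebra_simps)
  then show ?thesis
    using assms by (simp add: dvd_add)
qed

lemma seven_dvd_binomial_power:
  fixes x :: "'a::comm_ring_1"
  shows "7 dvd (1 + (-1) * x) ^ 7 - (1 + (-1) * x ^ 7)"
proof
  \<comment> \<open>The coefficients are 7, 21, 35, 35, 21, 7 divided by 7, with alternating
    signs.\<close>
  show "(1 + (-1) * x) ^ 7 - (1 + (-1) * x ^ 7) = 7 * (- x + 3 * x ^ 2 - 5 * x ^ 3 + 5 * x ^ 4 - 3 * x ^ 5 + x ^ 6)"
    by (simp add: eval_nat_numeral algebra_simps)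
qed

text \<open>The Frobenius congruence for each factor carries over to finite products; every
  coefficient of the limit is already one of a finite product.\<close>

lemma seven_dvd_eu_power:
  assumes "r > 0"
  shows "7 dvd eu r ^ 7 - eu (7 * r)"
proof -
  have fin: "7 dvd qprod (-1) r r m ^ 7 - qprod (-1) (7 * r) (7 * r) m" for m
  proof (induction m)
    case (Suc m)
    have "7 * r + 7 * r * m = (r + r * m) * 7"
      by simp
    then have "7 dvd (1 + fps_const (-1) * (fps_X :: int fps) ^ (r + r * m)) ^ 7 - (1 + fps_const (-1) * fps_X ^ (7 * r + 7 * r * m))"
      using seven_dvd_binomial_power[of "(fps_X :: int fps) ^ (r + r * m)"]
      by (simp only: power_mult fps_const_neg [symmetric] fps_const_1_eq_1)
    with Suc show ?case
      unfolding qprod_Suc power_mult_distrib by (rule dvd_diff_mult)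
  qed simp
  have "(\<lambda>m. qprod (-1) r r m ^ 7 + (-1) * qprod (-1) (7 * r) (7 * r) m) \<longlonglongrightarrow> eu r ^ 7 + (-1) * eu (7 * r)"
    using assms by (intro tendsto_add_fps tendsto_mult_fps tendsto_power_fps tendsto_const eu_tendsto) auto
  then have lim: "(\<lambda>m. qprod (-1) r r m ^ 7 - qprod (-1) (7 * r) (7 * r) m) \<longlonglongrightarrow> eu r ^ 7 - eu (7 * r)"
    by simp
  show ?thesis
    unfolding numeral_dvd_fps_iff
  proof
    fix n
    have "\<forall>\<^sub>F m in sequentially. fps_nth (qprod (-1) r r m ^ 7 - qprod (-1) (7 * r) (7 * r) m) n = fps_nth (eu r ^ 7 - eu (7 * r)) n"
      using lim unfolding tendsto_fps_iff by blast
    then obtain m where "fps_nth (qprod (-1) r r m ^ 7 - qprod (-1) (7 * r) (7 * r) m) n = fps_nth (eu r ^ 7 - eu (7 * r)) n"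
      using eventually_happens by force
    then show "7 dvd fps_nth (eu r ^ 7 - eu (7 * r)) n"
      using fin[of m] unfolding numeral_dvd_fps_iff by metis
  qed
qed

lemma fps_nth_mult_dvd:
  fixes f g :: "'a::comm_ring_1 fps"
  assumes "\<And>i. i \<le> n \<Longrightarrow> d dvd fps_nth f i * fps_nth g (n - i)"
  shows "d dvd fps_nth (f * g) n"
  unfolding fps_mult_nth using assms by (intro dvd_sum) auto

lemma iseries_nth_dvd:
  assumes "\<And>i. i \<in> I \<Longrightarrow> e i = int n \<Longrightarrow> d dvd c i"
  shows "d dvd fps_nth (iseries I e c) n"
  unfolding iseries_nth using assms by (intro dvd_sum) auto

lemma square_mod_7:
  fixes x :: int
  shows "x\<^sup>2 mod 7 \<in> {0, 1, 2, 4}" "x\<^sup>2 mod 7 = 0 \<Longrightarrow> 7 dvd x"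
proof -
  have *: "\<forall>r\<in>{0..<7::int}. r\<^sup>2 mod 7 \<in> {0, 1, 2, 4} \<and> (r\<^sup>2 mod 7 = 0 \<longrightarrow> r = 0)"
    by code_simp
  have "x mod 7 \<in> {0..<7}"
    by simp
  from bspec[OF * this] show "x\<^sup>2 mod 7 \<in> {0, 1, 2, 4}" "x\<^sup>2 mod 7 = 0 \<Longrightarrow> 7 dvd x"
    unfolding power_mod dvd_eq_mod_eq_0 by simp_all
qed

text \<open>As -1 is not a square modulo 7, no two of the nonzero squares 1, 2, 4 add up to
  0.\<close>

lemma seven_dvd_sum_squares:
  fixes x y :: int
  assumes "7 dvd x\<^sup>2 + y\<^sup>2"
  shows "7 dvd x" "7 dvd y"
proof -
  have *: "u mod 7 = 0 \<and> v mod 7 = 0"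
    if "7 dvd u + v" "u mod 7 \<in> {0, 1, 2, 4}" "v mod 7 \<in> {0, 1, 2, 4}" for u v :: int
    using that by (simp only: insert_iff empty_iff) presburger
  show "7 dvd x" "7 dvd y"
    using *[OF assms square_mod_7(1) square_mod_7(1)] square_mod_7(2) by simp_all
qed

lemma seven_dvd_square: "7 dvd x\<^sup>2 \<Longrightarrow> 7 dvd x" for x :: int
  using seven_dvd_sum_squares(1)[of x 0] by simp

section \<open>Partition numbers and Ramanujan's congruence modulo 7\<close>

definition partition_gf :: "int fps" where
  "partition_gf = fps_right_inverse (eu 1) 1"

lemma eu_partition_gf: "eu 1 * partition_gf = 1"
  unfolding partition_gf_def by (rule fps_right_inverse) simp

lemma eu_partition_gf_compose:
  assumes "k > 0"
  shows "eu k * (partition_gf oo fps_X ^ k) = 1"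
proof -
  have "eu k * (partition_gf oo fps_X ^ k) = eu 1 * partition_gf oo fps_X ^ k"
    using eu_compose[of 1 k] assms by (simp add: fps_compose_mult_distrib)
  then show ?thesis
    by (simp only: eu_partition_gf fps_compose_1)
qed

text \<open>Completing squares gives 8 i + 2 = (2 x + 1)^2 + (2 y + 1)^2, and 8 * 5 + 2 = 42. The
  factor 4 of the series is invertible modulo 7.\<close>

lemma seven_dvd_eu_sixth:
  assumes "i mod 7 = 5"
  shows "7 dvd fps_nth (eu 1 ^ 6) i"
proof -
  have "7 dvd fps_nth (4 * eu 1 ^ 6) i"
    unfolding eu_sixth_series
  proof (rule iseries_nth_dvd)
    fix p :: "int \<times> int"
    assume p: "(\<lambda>(x, y). tri x + tri y) p = int i"
    obtain x y where xy: "p = (x, y)"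
      by fastforce
    have "(2 * x + 1)\<^sup>2 + (2 * y + 1)\<^sup>2 = 4 * (2 * tri x + 2 * tri y) + 2"
      unfolding two_mult_tri by (simp add: power2_eq_square algebra_simps)
    also have "\<dots> = 8 * int i + 2"
      using p xy by simp
    also have "7 dvd \<dots>"
      using assms by presburger
    finally have "7 dvd 2 * x + 1"
      by (rule seven_dvd_sum_squares)
    then show "7 dvd (\<lambda>(x, y). (sg x * (2 * x + 1)) * (sg y * (2 * y + 1))) p"
      unfolding xy by simp
  qed
  then have "7 dvd 4 * fps_nth (eu 1 ^ 6) i"
    by (simp add: numeral_fps_const)
  then show ?thesis
    by presburger
qed

text \<open>Modulo 7, 1 / E_1 = E_1^6 / E_1^7 is E_1^6 / E_7. Dividing by a series in q^7 keeps
  exponents in their class modulo 7, so \<open>seven_dvd_eu_sixth\<close> applies.\<close>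

lemma ramanujan_seven:
  assumes "n mod 7 = 5"
  shows "7 dvd fps_nth partition_gf n"
proof -
  define p7 where "p7 = partition_gf oo fps_X ^ 7"
  have p7: "eu 7 * p7 = 1"
    unfolding p7_def by (rule eu_partition_gf_compose) simp
  have "partition_gf - eu 1 ^ 6 * p7 = partition_gf * (eu 7 * p7) - (eu 1 * partition_gf) * eu 1 ^ 6 * p7"
    by (simp only: p7 eu_partition_gf mult_1_left mult_1_right)
  also have "\<dots> = - (partition_gf * p7 * (eu 1 ^ 7 - eu 7))"
    by (simp add: algebra_simps eval_nat_numeral)
  also have "7 dvd \<dots>"
    using seven_dvd_eu_power[of 1] by simp
  finally have "7 dvd fps_nth (partition_gf - eu 1 ^ 6 * p7) n"
    unfolding numeral_dvd_fps_iff by blast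
  moreover have "7 dvd fps_nth (eu 1 ^ 6 * p7) n"
  proof (rule fps_nth_mult_dvd)
    fix i assume i: "i \<le> n"
    show "7 dvd fps_nth (eu 1 ^ 6) i * fps_nth p7 (n - i)"
    proof (cases "7 dvd n - i")
      case True
      then have "i mod 7 = 5"
        using mod_eq_dvd_iff_nat[OF i, of 7] assms by simp
      then show ?thesis
        using seven_dvd_eu_sixth by simp
    next
      case False
      then show ?thesis
        by (simp add: p7_def fps_nth_compose_X_power)
    qed
  qed
  ultimately show ?thesis
    by (simp add: dvd_diff_left_iff)
qed

text \<open>The sum of squares is 8 i + 5, divisible by 7 as 8 * 2 + 5 = 21; each linear factor of
  the weight then yields one 7, and -12 is invertible modulo 49.\<close>

lemma dvd_eu_fifth:
  assumes "i mod 7 = 2"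
  shows "49 dvd fps_nth (eu 1 ^ 5 * eu 2 ^ 5) i"
proof -
  have "49 dvd fps_nth (-12 * (eu 1 ^ 5 * eu 2 ^ 5)) i"
    unfolding eu_fifth_series
  proof (rule iseries_nth_dvd)
    fix p :: "int \<times> int"
    assume p: "(\<lambda>(j, k). tri j + 4 * tri k) p = int i"
    obtain x y where xy: "p = (x, y)"
      by fastforce
    have "(2 * x + 1)\<^sup>2 + (2 * (2 * y + 1))\<^sup>2 = 4 * (2 * tri x + 4 * (2 * tri y)) + 5"
      unfolding two_mult_tri by (simp add: power2_eq_square algebra_simps)
    also have "\<dots> = 8 * int i + 5"
      using p xy by simp
    also have "7 dvd \<dots>"
      using assms by presburger
    finally have *: "7 dvd (2 * x + 1)\<^sup>2 + (2 * (2 * y + 1))\<^sup>2" .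
    then have "7 dvd 2 * x + 1"
      by (rule seven_dvd_sum_squares)
    moreover have "7 dvd 2 * (2 * y + 1)"
      using * by (rule seven_dvd_sum_squares)
    then have "7 dvd 2 * y + 1"
      by presburger
    ultimately have "7 * 7 dvd (2 * x + 1) * (2 * y + 1)"
      by (rule mult_dvd_mono)
    then have "49 dvd ((2 * x + 1) * (2 * y + 1)) * (sg (tri x) * sg x * sg y * ((2 * x + 1)\<^sup>2 - 4 * (2 * y + 1)\<^sup>2))"
      by (simp add: dvd_mult2)
    then show "49 dvd (\<lambda>(j, k). (sg (tri j) * (sg j * (2 * j + 1))) * (sg k * (2 * k + 1)) * ((2 * j + 1)\<^sup>2 - 4 * (2 * k + 1)\<^sup>2)) p"
      unfolding xy prod.case by (simp only: mult_ac)
  qed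
  moreover have "-12 = (fps_const (-12) :: int fps)"
    by (simp add: numeral_fps_const)
  ultimately have "49 dvd -12 * fps_nth (eu 1 ^ 5 * eu 2 ^ 5) i"
    by (metis fps_mult_left_const_nth)
  moreover have "coprime 49 (-12 :: int)"
    by (simp add: coprime_iff_gcd_eq_1 gcd_non_0_int)
  ultimately show ?thesis
    using coprime_dvd_mult_right_iff by blast
qed

lemma mod_49_eqI:
  assumes "coprime 49 c" "49 dvd c * (int i - int r)" "r < 49"
  shows "i mod 49 = r"
proof -
  have "49 dvd int i - int r"
    using assms coprime_dvd_mult_right_iff by blast
  then have "int (i mod 49) = int (r mod 49)"
    by (simp add: zmod_int mod_eq_dvd_iff)
  with assms(3) show ?thesis
    by simp
qed

text \<open>From 24 i + 1 = (6 n + 1)^2: once 7 divides the left-hand side, so does 49. The sharper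
  class modulo 49 is what later places the partition number at an index 7 k + 5.\<close>

lemma dvd_H_series:
  assumes "i mod 7 = 2"
  shows "7 dvd fps_nth H_series i" "fps_nth H_series i \<noteq> 0 \<Longrightarrow> i mod 49 = 2"
proof -
  have *: "7 dvd 6 * n + 1 \<and> i mod 49 = 2" if "n * (3 * n + 1) div 2 = int i" for n
  proof -
    have "2 * (n * (3 * n + 1) div 2) = n * (3 * n + 1)"
      by simp
    then have "2 * int i = n * (3 * n + 1)"
      unfolding that .
    then have eq: "(6 * n + 1)\<^sup>2 = 24 * int i + 1"
      by (simp add: power2_eq_square algebra_simps)
    moreover have "7 dvd 24 * int i + 1"
      using assms by presburger
    ultimately have 1: "7 dvd 6 * n + 1"
      by (metis seven_dvd_square)
    then have "7 * 7 dvd (6 * n + 1)\<^sup>2"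
      unfolding power2_eq_square by (intro mult_dvd_mono)
    \<comment> \<open>Subtracting 49 = 24 * 2 + 1 exhibits the residue 2.\<close>
    then have "49 dvd (6 * n + 1)\<^sup>2 - 49"
      by simp
    also have "(6 * n + 1)\<^sup>2 - 49 = 24 * (int i - int 2)"
      using eq by simp
    finally have "i mod 49 = 2"
      by (rule mod_49_eqI[rotated]) (simp_all add: coprime_iff_gcd_eq_1 gcd_non_0_int)
    with 1 show ?thesis
      by simp
  qed
  show "7 dvd fps_nth H_series i"
    unfolding H_series_def by (rule iseries_nth_dvd) (use * in auto)
  show "i mod 49 = 2" if "fps_nth H_series i \<noteq> 0"
  proof (rule ccontr)
    assume "i mod 49 \<noteq> 2"
    then have "{n. n * (3 * n + 1) div 2 = int i} = {}"
      using * by auto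
    with that show False
      by (simp add: H_series_def iseries_nth)
  qed
qed

lemma dvd_K_series:
  assumes "i mod 7 = 2"
  shows "7 dvd fps_nth K_series i" "fps_nth K_series i \<noteq> 0 \<Longrightarrow> i mod 49 = 16"
proof -
  have *: "7 dvd 3 * n + 1 \<and> i mod 49 = 16" if "3 * n\<^sup>2 + 2 * n = int i" for n
  proof -
    have eq: "(3 * n + 1)\<^sup>2 = 3 * int i + 1"
      unfolding that [symmetric] by (simp add: power2_eq_square algebra_simps)
    moreover have "7 dvd 3 * int i + 1"
      using assms by presburger
    ultimately have 1: "7 dvd 3 * n + 1"
      by (metis seven_dvd_square)
    then have "7 * 7 dvd (3 * n + 1)\<^sup>2"
      unfolding power2_eq_square by (intro mult_dvd_mono)
    \<comment> \<open>Here 49 = 3 * 16 + 1, hence the residue 16.\<close>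
    then have "49 dvd (3 * n + 1)\<^sup>2 - 49"
      by simp
    also have "(3 * n + 1)\<^sup>2 - 49 = 3 * (int i - int 16)"
      using eq by simp
    finally have "i mod 49 = 16"
      by (rule mod_49_eqI[rotated]) (simp_all add: coprime_iff_gcd_eq_1 gcd_non_0_int)
    with 1 show ?thesis
      by simp
  qed
  show "7 dvd fps_nth K_series i"
    unfolding K_series_def by (rule iseries_nth_dvd) (use * in auto)
  show "i mod 49 = 16" if "fps_nth K_series i \<noteq> 0"
  proof (rule ccontr)
    assume "i mod 49 \<noteq> 16"
    then have "{n. 3 * n\<^sup>2 + 2 * n = int i} = {}"
      using * by auto
    with that show False
      by (simp add: K_series_def iseries_nth)
  qed
qed

text \<open>The product of the two differences is multiplied by f / (E_7 E_14) and expanded; f E_1^7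
  = \<open>H_series\<close> and f E_2^7 = \<open>K_series\<close> since f inverts E_1^2
  E_2^2.\<close>

lemma cubic_pair_gf_mod_49:
  defines "p7 \<equiv> partition_gf oo fps_X ^ 7" and "p14 \<equiv> partition_gf oo fps_X ^ 14"
  shows "49 dvd cubic_pair_gf - (H_series * p7 + K_series * p14 - eu 1 ^ 5 * eu 2 ^ 5 * (p7 * p14))"
proof -
  define f where "f = cubic_pair_gf"
  have p: "eu 7 * p7 = 1" "eu 14 * p14 = 1"
    unfolding p7_def p14_def by (rule eu_partition_gf_compose; simp)+
  have f: "eu 1 ^ 2 * eu 2 ^ 2 * f = 1"
    using cubic_pair_gf_unique[of cubic_pair_gf] by (simp add: cubic_pair_denom_def eu_def f_def)
  have H: "H_series * eu 2 ^ 2 = eu 1 ^ 5"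
  proof -
    have "H_series * eu 2 ^ 2 = eu 1 ^ 3 * (phi_minus * eu 2)"
      using H_series_product by (simp add: power2_eq_square mult_ac)
    then show ?thesis
      by (simp add: phi_minus_product flip: power_add)
  qed
  have K: "K_series * eu 1 ^ 2 = eu 2 ^ 5"
  proof -
    have "K_series * eu 1 ^ 2 * eu 4 = (phi * eu 1 ^ 2 * eu 4 ^ 2) * eu 4"
      using K_series_product by (simp add: eval_nat_numeral mult_ac)
    then have "K_series * eu 1 ^ 2 = phi * eu 1 ^ 2 * eu 4 ^ 2"
      by (subst (asm) mult_right_cancel) simp_all
    then show ?thesis
      by (simp only: phi_product)
  qed
  have f1: "f * eu 1 ^ 7 = H_series"
  proof -
    have "f * eu 1 ^ 7 = eu 1 ^ 5 * (eu 1 ^ 2 * f)"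
      by (simp add: mult_ac flip: power_add)
    also have "\<dots> = H_series * (eu 1 ^ 2 * eu 2 ^ 2 * f)"
      unfolding H [symmetric] by (simp only: mult_ac)
    finally show ?thesis
      by (simp only: f mult_1_right)
  qed
  have f2: "f * eu 2 ^ 7 = K_series"
  proof -
    have "f * eu 2 ^ 7 = eu 2 ^ 5 * (eu 2 ^ 2 * f)"
      by (simp add: mult_ac flip: power_add)
    also have "\<dots> = K_series * (eu 1 ^ 2 * eu 2 ^ 2 * f)"
      unfolding K [symmetric] by (simp only: mult_ac)
    finally show ?thesis
      by (simp only: f mult_1_right)
  qed
  have f12: "f * eu 1 ^ 7 * eu 2 ^ 7 = eu 1 ^ 5 * eu 2 ^ 5"
  proof -
    have "f * eu 1 ^ 7 * eu 2 ^ 7 = H_series * eu 2 ^ 2 * eu 2 ^ 5"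
      unfolding f1 by (simp add: mult.assoc flip: power_add)
    then show ?thesis
      by (simp add: H)
  qed
  have "7 * 7 dvd (eu 1 ^ 7 - eu 7) * (eu 2 ^ 7 - eu 14)"
    using seven_dvd_eu_power[of 1] seven_dvd_eu_power[of 2] by (intro mult_dvd_mono) simp_all
  moreover have "7 * 7 = (49 :: int fps)"
    by simp
  ultimately have "49 dvd ((eu 1 ^ 7 - eu 7) * (eu 2 ^ 7 - eu 14)) * (f * p7 * p14)"
    by (metis dvd_mult2)
  also have "((eu 1 ^ 7 - eu 7) * (eu 2 ^ 7 - eu 14)) * (f * p7 * p14) =
      (f * eu 1 ^ 7 * eu 2 ^ 7) * (p7 * p14) - (f * eu 1 ^ 7) * p7 * (eu 14 * p14)
      - (f * eu 2 ^ 7) * p14 * (eu 7 * p7) + f * (eu 7 * p7) * (eu 14 * p14)"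
    by (simp add: algebra_simps)
  also have "\<dots> = f - (H_series * p7 + K_series * p14 - eu 1 ^ 5 * eu 2 ^ 5 * (p7 * p14))"
    unfolding f12 unfolding f1 f2 p by simp
  finally show ?thesis
    unfolding f_def .
qed

theorem theorem1p1:
  fixes n :: nat
  shows "[b (49 * n + 37) = 0] (mod 49)"
proof -
  define N where "N = 49 * n + 37"
  have N7: "N mod 7 = 2"
    unfolding N_def by presburger
  define p7 where "p7 = partition_gf oo fps_X ^ 7"
  define p14 where "p14 = partition_gf oo fps_X ^ 14"
  have p7: "fps_nth p7 k = (if 7 dvd k then fps_nth partition_gf (k div 7) else 0)" for k
    unfolding p7_def by (rule fps_nth_compose_X_power) simp
  have p14: "fps_nth p14 k = (if 14 dvd k then fps_nth partition_gf (k div 14) else 0)" for k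
    unfolding p14_def by (rule fps_nth_compose_X_power) simp
  have "49 dvd fps_nth (H_series * p7) N"
  proof (rule fps_nth_mult_dvd)
    fix i assume i: "i \<le> N"
    show "49 dvd fps_nth H_series i * fps_nth p7 (N - i)"
    proof (cases "7 dvd N - i \<and> fps_nth H_series i \<noteq> 0")
      case True
      then have 7: "7 dvd N - i" and i7: "i mod 7 = 2"
        using mod_eq_dvd_iff_nat[OF i, of 7] N7 by simp_all
      then have "i mod 49 = 2"
        using True dvd_H_series(2) by blast
      then obtain a where a: "i = 49 * a + 2"
        by (metis mult_div_mod_eq)
      with i obtain c where "n = a + c"
        unfolding N_def using le_Suc_ex[of a n] by force
      \<comment> \<open>From 37 - 2 = 35 = 7 * 5.\<close>
      with a have "N - i = 7 * (7 * c + 5)"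
        by (simp add: N_def)
      then have "((N - i) div 7) mod 7 = 5"
        by simp
      then have "7 * 7 dvd fps_nth H_series i * fps_nth p7 (N - i)"
        using 7 by (intro mult_dvd_mono dvd_H_series(1)[OF i7]) (simp add: p7 ramanujan_seven)
      then show ?thesis
        by simp
    qed (auto simp: p7)
  qed
  moreover have "49 dvd fps_nth (K_series * p14) N"
  proof (rule fps_nth_mult_dvd)
    fix i assume i: "i \<le> N"
    show "49 dvd fps_nth K_series i * fps_nth p14 (N - i)"
    proof (cases "14 dvd N - i \<and> fps_nth K_series i \<noteq> 0")
      case True
      then have 14: "14 dvd N - i"
        by simp
      then have "7 dvd N - i"
        by (rule dvd_trans[rotated]) simp
      then have i7: "i mod 7 = 2"
        using mod_eq_dvd_iff_nat[OF i, of 7] N7 by simp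
      then have "i mod 49 = 16"
        using True dvd_K_series(2) by blast
      then obtain a where a: "i = 49 * a + 16"
        by (metis mult_div_mod_eq)
      with i obtain c where "n = a + c"
        unfolding N_def using le_Suc_ex[of a n] by force
      with a have Ni: "N - i = 49 * c + 21"
        by (simp add: N_def)
      \<comment> \<open>Here 37 - 16 = 21 = 7 * 3 alone is not of the right form; evenness makes c
        odd, and then 49 + 21 = 70 = 14 * 5 gives the index 7 d + 5.\<close>
      have "even (N - i)"
        using 14 by (rule dvd_trans[rotated]) simp
      then have "odd c"
        unfolding Ni by simp
      then obtain d where "c = 2 * d + 1"
        by (rule oddE)
      with Ni have "N - i = 14 * (7 * d + 5)"
        by simp
      then have "((N - i) div 14) mod 7 = 5"
        by simp
      then have "7 * 7 dvd fps_nth K_series i * fps_nth p14 (N - i)"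
        using 14 by (intro mult_dvd_mono dvd_K_series(1)[OF i7]) (simp add: p14 ramanujan_seven)
      then show ?thesis
        by simp
    qed (auto simp: p14)
  qed
  moreover have "49 dvd fps_nth (eu 1 ^ 5 * eu 2 ^ 5 * (p7 * p14)) N"
  proof (rule fps_nth_mult_dvd)
    fix i assume i: "i \<le> N"
    \<comment> \<open>The product is a series in q^7, so only i in the class 2 of N modulo 7
      contribute, where \<open>dvd_eu_fifth\<close> applies.\<close>
    have "fps_nth (p7 * p14) k = 0" if "\<not> 7 dvd k" for k
      unfolding fps_mult_nth
    proof (rule sum.neutral, rule ballI)
      fix l assume l: "l \<in> {0..k}"
      have "\<not> (7 dvd l \<and> 14 dvd k - l)"
      proof
        assume *: "7 dvd l \<and> 14 dvd k - l"
        have "7 dvd k - l"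
          using conjunct2[OF *] by (rule dvd_trans[rotated]) simp
        then show False
          using that * l by (auto dest: dvd_diffD)
      qed
      then show "fps_nth p7 l * fps_nth p14 (k - l) = 0"
        by (auto simp: p7 p14)
    qed
    moreover have "i mod 7 = 2" if "7 dvd N - i"
      using that mod_eq_dvd_iff_nat[OF i, of 7] N7 by simp
    ultimately show "49 dvd fps_nth (eu 1 ^ 5 * eu 2 ^ 5) i * fps_nth (p7 * p14) (N - i)"
      using dvd_eu_fifth[of i] by (cases "7 dvd N - i") auto
  qed
  moreover have "49 dvd fps_nth (cubic_pair_gf - (H_series * p7 + K_series * p14 - eu 1 ^ 5 * eu 2 ^ 5 * (p7 * p14))) N"
    using cubic_pair_gf_mod_49 unfolding numeral_dvd_fps_iff p7_def p14_def by blast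
  ultimately have "49 dvd fps_nth cubic_pair_gf N"
    unfolding fps_sub_nth fps_add_nth by (metis diff_add_cancel dvd_add dvd_diff)
  then show ?thesis
    by (simp add: cong_0_iff b_def N_def)
qed

end
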